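(* Let $r\in(0,1)$ be a constant and let $V:\mathbb{R}\to\mathbb{R}$ be a continuously differentiable function with unique global minimum $x^*$ such that $x\cdot\nabla V(x)\ge rV(x)\ge0$ for all $x$. Let $\rho(t)$ be the solution of the Quantum Langevin Dynamics with potential $V$ and constant parameters $\eta,\hbar,m,\Omega,k,T>0$, and assume that $\langle\nabla^2V\rangle_t<+\infty$, uniformly in $t\ge0$. If the initial density matrix $\rho(0)$ satisfies $\langle H\rangle_0-\frac{\zeta}{r}kT\ge0$, then in the regime $\hbar\Omega\ll kT$, $$\langle V(x)\rangle_t-V(x^* )\le\frac{\zeta}{r}kT+O(e^{-\eta rt}),$$ where $\zeta=2+O\left(\frac{\hbar\Omega}{kT}\right)$ is a constant independent of $t$.
   Context: Setting (one-dimensional Quantum Langevin Dynamics, QLD). $x$ and $p=-\mathrm{i}\hbar\frac{\mathrm d}{\mathrm dx}$ are the position and momentum operators, $H=\frac{p^2}{2m}+V(x)$, and the density matrix $\rho(t)$ evolves by the Lindblad equation $$\frac{\mathrm d\rho}{\mathrm dt}=-\frac{\mathrm i}{\hbar}[H,\rho]+2L\rho L^\dagger-L^\dagger L\rho-\rho L^\dagger L,\qquad L=\mu x+\mathrm i\nu p,\quad L^\dagger=\mu x-\mathrm i\nu p,$$ with $$\mu^2=\frac{\eta m\Omega}{2\hbar}\coth\left(\frac{\hbar\Omega}{4kT}\right),\qquad \nu^2=\frac{\eta}{2\hbar m\Omega}\tanh\left(\frac{\hbar\Omega}{4kT}\right),\qquad \mu,\nu>0,\quad 2\mu\nu\hbar=\eta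 .$$ Here $m$ is the mass, $\Omega$ a frequency, $k$ the Boltzmann constant, $T$ the temperature, $\eta$ the damping rate; all are positive constants. $\langle O\rangle_t=\mathrm{Tr}(\rho(t)O)$. $\nabla V=V'$, $\nabla^2V=V''$. Conventions. The regime $\hbar\Omega\ll kT$ means $\hbar\Omega/(kT)$ small; $\zeta=2+O(\hbar\Omega/(kT))$ is understood as $\hbar\Omega/(kT)\to0$, with implied constant allowed to depend on $m$, $\Omega$ and $\sup_{t\ge0}\langle\nabla^2V\rangle_t$. $O(e^{-\eta rt})$ is as $t\to+\infty$, with implied constant independent of $t$. As customary in physics, $\rho(t)$ is assumed regular enough that all expectation values that occur are finite, differentiable in $t$, and computable with cyclicity of the trace and the canonical commutation relation $[x,p]=\mathrm i\hbar$. *)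

theory Defs
  imports "HOL-Analysis.Analysis"
begin

subsection \<open>Operators on wave functions\<close>

type_synonym wave = "real \<Rightarrow> complex"

definition mult_op :: "(real \<Rightarrow> real) \<Rightarrow> wave \<Rightarrow> wave" where
  "mult_op f \<psi> = (\<lambda>x. of_real (f x) * \<psi> x)"

definition position_op :: "wave \<Rightarrow> wave" where
  "position_op = mult_op (\<lambda>x. x)"

definition momentum_op :: "real \<Rightarrow> wave \<Rightarrow> wave" where
  "momentum_op hbar \<psi> = (\<lambda>x. - \<i> * of_real hbar * vector_derivative \<psi> (at x))"

definition hamiltonian :: "real \<Rightarrow> real \<Rightarrow> (real \<Rightarrow> real) \<Rightarrow> wave \<Rightarrow> wave" where
  "hamiltonian hbar m V \<psi> =
     (\<lambda>x. momentum_op hbar (momentum_op hbar \<psi>) x / of_real (2 * m) + mult_op V \<psi> x)"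

definition coth :: "real \<Rightarrow> real" where
  "coth x = cosh x / sinh x"

definition qld_mu :: "real \<Rightarrow> real \<Rightarrow> real \<Rightarrow> real \<Rightarrow> real \<Rightarrow> real \<Rightarrow> real" where
  "qld_mu hbar m \<Omega> kB T \<eta> =
     sqrt (\<eta> * m * \<Omega> / (2 * hbar) * coth (hbar * \<Omega> / (4 * kB * T)))"

definition qld_nu :: "real \<Rightarrow> real \<Rightarrow> real \<Rightarrow> real \<Rightarrow> real \<Rightarrow> real \<Rightarrow> real" where
  "qld_nu hbar m \<Omega> kB T \<eta> =
     sqrt (\<eta> / (2 * hbar * m * \<Omega>) * tanh (hbar * \<Omega> / (4 * kB * T)))"

definition jump_op :: "real \<Rightarrow> real \<Rightarrow> real \<Rightarrow> wave \<Rightarrow> wave" where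
  "jump_op hbar \<mu> \<nu> \<psi> =
     (\<lambda>x. of_real \<mu> * position_op \<psi> x + \<i> * of_real \<nu> * momentum_op hbar \<psi> x)"

definition jump_adj_op :: "real \<Rightarrow> real \<Rightarrow> real \<Rightarrow> wave \<Rightarrow> wave" where
  "jump_adj_op hbar \<mu> \<nu> \<psi> =
     (\<lambda>x. of_real \<mu> * position_op \<psi> x - \<i> * of_real \<nu> * momentum_op hbar \<psi> x)"

subsection \<open>Density matrices in the position representation\<close>

text \<open>An operator on \<open>L\<^sup>2(\<real>)\<close> is represented by its integral kernel
  \<open>\<kappa> x y = \<langle>x|\<kappa>|y\<rangle>\<close>.  The density matrices considered below have \<open>C\<^sup>4\<close> kernels, so
  that diagonal values are meaningful.\<close>

type_synonym kernel = "real \<Rightarrow> real \<Rightarrow> complex"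

definition kernel_adj :: "kernel \<Rightarrow> kernel" where
  "kernel_adj \<kappa> = (\<lambda>x y. cnj (\<kappa> y x))"

text \<open>\<open>lmul A \<kappa>\<close> is the kernel of \<open>A \<kappa>\<close>.  \<open>rmul_adj A \<kappa>\<close> is the kernel of
  \<open>\<kappa> A\<^sup>\<dagger> = (A \<kappa>\<^sup>\<dagger>)\<^sup>\<dagger>\<close>; for a symmetric operator \<open>A\<close> (such as position, momentum,
  the Hamiltonian, or multiplication by a real function) this is \<open>\<kappa> A\<close>.\<close>

definition lmul :: "(wave \<Rightarrow> wave) \<Rightarrow> kernel \<Rightarrow> kernel" where
  "lmul A \<kappa> = (\<lambda>x y. A (\<lambda>s. \<kappa> s y) x)"

definition rmul_adj :: "(wave \<Rightarrow> wave) \<Rightarrow> kernel \<Rightarrow> kernel" where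
  "rmul_adj A \<kappa> = kernel_adj (lmul A (kernel_adj \<kappa>))"

definition kernel_trace :: "kernel \<Rightarrow> complex" where
  "kernel_trace \<kappa> = (LINT x|lborel. \<kappa> x x)"

text \<open>\<open>Tr (\<kappa> A)\<close> for symmetric \<open>A\<close>; it is real when \<open>\<kappa>\<close> is self-adjoint.\<close>

definition expectation :: "(wave \<Rightarrow> wave) \<Rightarrow> kernel \<Rightarrow> real" where
  "expectation A \<kappa> = Re (kernel_trace (rmul_adj A \<kappa>))"

definition square_integrable :: "wave \<Rightarrow> bool" where
  "square_integrable \<psi> \<longleftrightarrow>
     \<psi> \<in> borel_measurable borel \<and> integrable lborel (\<lambda>x. (cmod (\<psi> x))\<^sup>2)"

text \<open>Self-adjoint, positive, of trace one.  Square integrability of the kernel says that the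
  operator is Hilbert--Schmidt, as every density matrix is.\<close>

definition density_kernel :: "kernel \<Rightarrow> bool" where
  "density_kernel \<kappa> \<longleftrightarrow>
     (\<lambda>(x, y). \<kappa> x y) \<in> borel_measurable borel \<and>
     integrable (lborel \<Otimes>\<^sub>M lborel) (\<lambda>(x, y). (cmod (\<kappa> x y))\<^sup>2) \<and>
     kernel_adj \<kappa> = \<kappa> \<and>
     (\<forall>\<psi>. square_integrable \<psi> \<longrightarrow>
        0 \<le> Re (LINT x|lborel. cnj (\<psi> x) * (LINT y|lborel. \<kappa> x y * \<psi> y))) \<and>
     integrable lborel (\<lambda>x. \<kappa> x x) \<and>
     kernel_trace \<kappa> = 1"

subsection \<open>Quantum Langevin dynamics\<close>

text \<open>The right-hand side
  \<open>-(\<i>/\<hbar>)[H, \<kappa>] + 2 L \<kappa> L\<^sup>\<dagger> - L\<^sup>\<dagger> L \<kappa> - \<kappa> L\<^sup>\<dagger> L\<close> of the Lindblad equation.\<close>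

definition lindbladian ::
  "real \<Rightarrow> real \<Rightarrow> real \<Rightarrow> real \<Rightarrow> real \<Rightarrow> real \<Rightarrow> (real \<Rightarrow> real) \<Rightarrow> kernel \<Rightarrow> kernel" where
  "lindbladian hbar m \<Omega> kB T \<eta> V \<kappa> =
     (let H = hamiltonian hbar m V;
          \<mu> = qld_mu hbar m \<Omega> kB T \<eta>;
          \<nu> = qld_nu hbar m \<Omega> kB T \<eta>;
          L = jump_op hbar \<mu> \<nu>;
          L' = jump_adj_op hbar \<mu> \<nu>
      in (\<lambda>x y. - (\<i> / of_real hbar) * (lmul H \<kappa> x y - rmul_adj H \<kappa> x y)
                + 2 * lmul L (rmul_adj L \<kappa>) x y
                - lmul (L' \<circ> L) \<kappa> x y - rmul_adj (L' \<circ> L) \<kappa> x y))"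

definition qld_solution ::
  "real \<Rightarrow> real \<Rightarrow> real \<Rightarrow> real \<Rightarrow> real \<Rightarrow> real \<Rightarrow> (real \<Rightarrow> real) \<Rightarrow> (real \<Rightarrow> kernel) \<Rightarrow> bool" where
  "qld_solution hbar m \<Omega> kB T \<eta> V \<rho> \<longleftrightarrow>
     (\<forall>t\<ge>0. density_kernel (\<rho> t)) \<and>
     (\<forall>t\<ge>0. \<forall>x y. ((\<lambda>s. \<rho> s x y) has_vector_derivative
         lindbladian hbar m \<Omega> kB T \<eta> V (\<rho> t) x y) (at t within {0..}))"

subsection \<open>Regularity of the solution\<close>

fun smooth_kernel :: "nat \<Rightarrow> kernel \<Rightarrow> bool" where
  "smooth_kernel 0 \<kappa> \<longleftrightarrow> continuous_on UNIV (\<lambda>(x, y). \<kappa> x y)"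
| "smooth_kernel (Suc n) \<kappa> \<longleftrightarrow>
     continuous_on UNIV (\<lambda>(x, y). \<kappa> x y) \<and>
     (\<forall>x y. (\<lambda>s. \<kappa> s y) differentiable (at x) \<and> (\<lambda>s. \<kappa> x s) differentiable (at y)) \<and>
     smooth_kernel n (\<lambda>x y. vector_derivative (\<lambda>s. \<kappa> s y) (at x)) \<and>
     smooth_kernel n (\<lambda>x y. vector_derivative (\<lambda>s. \<kappa> x s) (at y))"

text \<open>The products \<open>A \<kappa> B\<close>, where \<open>A\<close> and \<open>B\<close> are monomials in the operators \<open>x\<close>, \<open>p\<close> (of
  weight 1) and \<open>V\<close> (of weight 2), together with the total weight.\<close>

inductive moment_kernel :: "real \<Rightarrow> (real \<Rightarrow> real) \<Rightarrow> kernel \<Rightarrow> nat \<Rightarrow> kernel \<Rightarrow> bool"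
  for hbar :: real and V :: "real \<Rightarrow> real" and \<kappa> :: kernel where
  base: "moment_kernel hbar V \<kappa> 0 \<kappa>"
| x_left: "moment_kernel hbar V \<kappa> n \<tau> \<Longrightarrow> moment_kernel hbar V \<kappa> (n + 1) (lmul position_op \<tau>)"
| x_right: "moment_kernel hbar V \<kappa> n \<tau> \<Longrightarrow> moment_kernel hbar V \<kappa> (n + 1) (rmul_adj position_op \<tau>)"
| p_left: "moment_kernel hbar V \<kappa> n \<tau> \<Longrightarrow> moment_kernel hbar V \<kappa> (n + 1) (lmul (momentum_op hbar) \<tau>)"
| p_right: "moment_kernel hbar V \<kappa> n \<tau> \<Longrightarrow> moment_kernel hbar V \<kappa> (n + 1) (rmul_adj (momentum_op hbar) \<tau>)"
| V_left: "moment_kernel hbar V \<kappa> n \<tau> \<Longrightarrow> moment_kernel hbar V \<kappa> (n + 2) (lmul (mult_op V) \<tau>)"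
| V_right: "moment_kernel hbar V \<kappa> n \<tau> \<Longrightarrow> moment_kernel hbar V \<kappa> (n + 2) (rmul_adj (mult_op V) \<tau>)"

text \<open>Weight 4 is what \<open>Tr ((d\<rho>/dt) H)\<close> requires: \<open>H\<close> has weight 2 and \<open>L\<close> weight 1.
  These moments include, through commutators, the expectations of \<open>x V'\<close> and of
  \<open>V'' = -[p, [p, V]] / \<hbar>\<^sup>2\<close>.  Cyclicity of the trace and the canonical commutation relation are
  not assumed.  The last clause says that the energy expectation is differentiable and that
  its derivative is \<open>Tr ((d\<rho>/dt) H)\<close>.\<close>

definition qld_regular ::
  "real \<Rightarrow> real \<Rightarrow> real \<Rightarrow> real \<Rightarrow> real \<Rightarrow> real \<Rightarrow> (real \<Rightarrow> real) \<Rightarrow> (real \<Rightarrow> kernel) \<Rightarrow> bool" where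
  "qld_regular hbar m \<Omega> kB T \<eta> V \<rho> \<longleftrightarrow>
     (\<forall>t\<ge>0. smooth_kernel 4 (\<rho> t)) \<and>
     (\<forall>t\<ge>0. \<forall>n\<le>4. \<forall>\<tau>. moment_kernel hbar V (\<rho> t) n \<tau> \<longrightarrow> integrable lborel (\<lambda>x. \<tau> x x)) \<and>
     (\<forall>t\<ge>0. ((\<lambda>s. expectation (hamiltonian hbar m V) (\<rho> s)) has_real_derivative
         expectation (hamiltonian hbar m V) (lindbladian hbar m \<Omega> kB T \<eta> V (\<rho> t)))
         (at t within {0..}))"

end

theory Submission
  imports Defs
begin

text \<open>
  Write \<open>n(x)\<close> for the diagonal \<open>\<rho>(x, x)\<close> and \<open>K \<ge> 0\<close> for the kinetic energy.  In the position
  representation, the integrand of \<open>Tr ((d\<rho>/dt) H)\<close> is the derivative of an integrable function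
  plus a few explicit terms; since the integral over the line of an integrable derivative of an
  integrable function vanishes, this replaces cyclicity of the trace and gives
  \<open>d\<langle>H\<rangle>/dt = - 2\<eta>K - \<eta>\<langle>x V'\<rangle> + \<nu>\<^sup>2 \<hbar>\<^sup>2 \<langle>V''\<rangle> + \<mu>\<^sup>2 \<hbar>\<^sup>2 / m\<close>.
  As \<open>K \<ge> 0\<close>, \<open>n \<ge> 0\<close>, \<open>x V' \<ge> r V\<close> and \<open>r < 1\<close>, the right-hand side is at most
  \<open>- \<eta>r\<langle>H\<rangle> + \<eta>\<zeta>kT\<close> with
  \<open>\<zeta> = 2 z coth z + (S u / (2 m \<Omega>\<^sup>2)) tanh z\<close>, \<open>u = \<hbar>\<Omega>/(kT) = 4 z\<close>.  Gronwall's inequality bounds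
  \<open>\<langle>H\<rangle>\<close>, which dominates \<open>\<langle>V\<rangle>\<close>, and \<open>V \<ge> 0\<close> at the minimum.
\<close>

subsection \<open>Integrals of derivatives and mixed partial derivatives\<close>

text \<open>With a nonzero limit, the norm of \<open>g\<close> would stay above
  \<open>norm L / 2\<close> on a half-line and its integral would exceed every bound. This supplies
  the boundary values when an integration by parts on the line assumes no decay.\<close>

lemma integrable_tendsto_at_top_imp_zero:
  fixes g :: "real \<Rightarrow> 'a::{banach, second_countable_topology}"
  assumes g: "integrable lborel g" and lim: "(g \<longlongrightarrow> L) at_top"
  shows "L = 0"
proof (rule ccontr)
  assume "L \<noteq> 0"
  define e where "e = norm L / 2"
  have e: "e > 0" using \<open>L \<noteq> 0\<close> by (simp add: e_def)
  have "((\<lambda>x. norm (g x)) \<longlongrightarrow> norm L) at_top"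
    using lim by (rule tendsto_norm)
  moreover have "e < norm L" using e by (simp add: e_def)
  ultimately have "\<forall>\<^sub>F x in at_top. e < norm (g x)"
    by (rule order_tendstoD)
  then obtain B where B: "\<And>x. x \<ge> B \<Longrightarrow> e < norm (g x)"
    by (auto simp: eventually_at_top_linorder)
  define M where "M = (LINT x|lborel. norm (g x))"
  have M0: "M \<ge> 0" by (simp add: M_def)
  \<comment> \<open>A rectangle of width \<open>N\<close> and height \<open>e\<close> has area
    \<open>M + 1\<close>, more than the integral of the norm allows.\<close>
  define N where "N = (M + 1) / e"
  have N: "N \<ge> 0" "N * e > M" using e M0 by (auto simp: N_def)
  have "N * e = (LINT x|lborel. indicator {B..B + N} x *\<^sub>R e)"
    using N by simp
  also have "\<dots> \<le> M"
    unfolding M_def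
  proof (rule integral_mono)
    show "integrable lborel (\<lambda>x. indicat_real {B..B + N} x *\<^sub>R e)"
      by (intro integrable_scaleR_left integrable_real_indicator) (auto simp: emeasure_lborel_Icc_eq)
    show "integrable lborel (\<lambda>x. norm (g x))" using g by simp
    show "indicat_real {B..B + N} x *\<^sub>R e \<le> norm (g x)" for x
      using B[of x] by (auto simp: indicator_def)
  qed
  finally show False using N by simp
qed

text \<open>By the fundamental theorem the integral over \<open>{-b..b}\<close> is
  \<open>f b - f (-b)\<close>, and by dominated convergence it tends to the integral over the line.
  As \<open>f b - f (-b)\<close> is itself integrable in \<open>b\<close>, the limit can only be
  zero.\<close>

lemma integral_derivative_eq_0:
  fixes f :: "real \<Rightarrow> 'a::euclidean_space"
  assumes der: "\<And>x. (f has_vector_derivative f' x) (at x)"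
    and f: "integrable lborel f" and f': "integrable lborel f'"
  shows "(LINT x|lborel. f' x) = 0"
proof -
  have FTC: "(LINT x|lborel. indicator {-b..b} x *\<^sub>R f' x) = f b - f (-b)" if "b \<ge> 0" for b
  proof -
    have s: "set_integrable lborel {-b..b} f'"
      using f' unfolding set_integrable_def by (intro integrable_mult_indicator) auto
    have "(f' has_integral f b - f (-b)) {-b..b}"
      using that der
      by (intro fundamental_theorem_of_calculus) (auto intro: has_vector_derivative_at_within)
    then show ?thesis
      using set_borel_integral_eq_integral(2)[OF s] by (simp add: integral_unique set_lebesgue_integral_def)
  qed
  have f'_meas[measurable]: "f' \<in> borel_measurable lborel" using f' by simp
  have "((\<lambda>b. LINT x|lborel. indicator {-b..b} x *\<^sub>R f' x) \<longlongrightarrow> (LINT x|lborel. f' x)) at_top"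
  proof (rule integral_dominated_convergence_at_top[where w = "\<lambda>x. norm (f' x)"])
    show "integrable lborel (\<lambda>x. norm (f' x))" using f' by simp
    show "\<forall>\<^sub>F i in at_top. AE x in lborel. norm (indicat_real {- i..i} x *\<^sub>R f' x) \<le> norm (f' x)"
      by (intro always_eventually allI AE_I2) (auto simp: indicator_def)
    show "AE x in lborel. ((\<lambda>b. indicat_real {- b..b} x *\<^sub>R f' x) \<longlongrightarrow> f' x) at_top"
    proof (rule AE_I2)
      fix x :: real
      have "\<forall>\<^sub>F b in at_top. indicat_real {- b..b} x *\<^sub>R f' x = f' x"
        using eventually_ge_at_top[of "\<bar>x\<bar>"] by eventually_elim (auto simp: indicator_def)
      then show "((\<lambda>b. indicat_real {- b..b} x *\<^sub>R f' x) \<longlongrightarrow> f' x) at_top"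
        by (rule tendsto_eventually)
    qed
  qed auto
  then have "((\<lambda>b. f b - f (-b)) \<longlongrightarrow> (LINT x|lborel. f' x)) at_top"
    by (rule Lim_transform_eventually)
      (use eventually_ge_at_top[of "0::real"] in eventually_elim, simp add: FTC)
  moreover have "integrable lborel (\<lambda>b. f b - f (-b))"
    using f lborel_integrable_real_affine[OF f, of "-1" 0] by simp
  ultimately show ?thesis
    using integrable_tendsto_at_top_imp_zero by blast
qed

section \<open>Symmetry of mixed partial derivatives\<close>

lemma continuous_on_corner:
  fixes f :: "real \<Rightarrow> real \<Rightarrow> 'a::metric_space"
  assumes "continuous_on UNIV (\<lambda>(x, y). f x y)" and "e > 0"
  shows "\<exists>h>0. \<forall>\<xi>\<in>{a..a + h}. \<forall>\<eta>\<in>{b..b + h}. dist (f \<xi> \<eta>) (f a b) < e"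
proof -
  obtain d where d: "d > 0" "\<And>z. dist z (a, b) < d \<Longrightarrow> dist (case z of (x, y) \<Rightarrow> f x y) (f a b) < e"
    using assms unfolding continuous_on_iff by fastforce
  show ?thesis
  proof (intro exI[of _ "d / 3"] conjI ballI)
    fix \<xi> \<eta> assume *: "\<xi> \<in> {a..a + d / 3}" "\<eta> \<in> {b..b + d / 3}"
    \<comment> \<open>Each coordinate contributes at most \<open>d / 3\<close>, so the sum stays
      strictly below \<open>d\<close>.\<close>
    have "dist (\<xi>, \<eta>) (a, b) \<le> dist \<xi> a + dist \<eta> b"
      unfolding dist_Pair_Pair by (rule sqrt_sum_squares_le_sum) auto
    also have "\<dots> < d" using * d(1) by (auto simp: dist_real_def)
    finally show "dist (f \<xi> \<eta>) (f a b) < e" using d(2) by force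
  qed (use d in auto)
qed

text \<open>Two mean value theorems: one in the first variable for the increment
  \<open>g s (b + k) - g s b\<close>, then one in the second variable for
  \<open>g1 \<xi>\<close>.\<close>

lemma second_difference_mvt:
  fixes g :: "real \<Rightarrow> real \<Rightarrow> real"
  assumes 1: "\<And>x y. ((\<lambda>s. g s y) has_real_derivative g1 x y) (at x)"
    and 12: "\<And>x y. ((\<lambda>s. g1 x s) has_real_derivative g12 x y) (at y)"
    and h: "h > 0" "k > 0"
  shows "\<exists>\<xi>\<in>{a..a + h}. \<exists>\<eta>\<in>{b..b + k}.
    g (a + h) (b + k) - g (a + h) b - g a (b + k) + g a b = h * k * g12 \<xi> \<eta>"
proof -
  have "\<exists>\<xi>>a. \<xi> < a + h \<and> (\<lambda>s. g s (b + k) - g s b) (a + h) - (\<lambda>s. g s (b + k) - g s b) a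
      = (a + h - a) * (g1 \<xi> (b + k) - g1 \<xi> b)"
    using h by (intro MVT2 DERIV_diff 1) auto
  then obtain \<xi> where \<xi>: "a < \<xi>" "\<xi> < a + h"
    "g (a + h) (b + k) - g (a + h) b - (g a (b + k) - g a b) = h * (g1 \<xi> (b + k) - g1 \<xi> b)"
    by auto
  have "\<exists>\<eta>>b. \<eta> < b + k \<and> g1 \<xi> (b + k) - g1 \<xi> b = (b + k - b) * g12 \<xi> \<eta>"
    using h by (intro MVT2 12) auto
  then obtain \<eta> where \<eta>: "b < \<eta>" "\<eta> < b + k" "g1 \<xi> (b + k) - g1 \<xi> b = k * g12 \<xi> \<eta>"
    by auto
  show ?thesis
    using \<xi> \<eta> by (intro bexI[of _ \<xi>] bexI[of _ \<eta>]) auto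
qed

text \<open>The second difference over a square does not depend on the order of the variables, so it
  equals \<open>h * h\<close> times a value of \<open>g12\<close> and also \<open>h * h\<close>
  times a value of \<open>g21\<close> in the same small square. Continuity at the corner then forces
  the two values there to agree.\<close>

lemma mixed_derivatives_commute_real:
  fixes g :: "real \<Rightarrow> real \<Rightarrow> real"
  assumes 1: "\<And>x y. ((\<lambda>s. g s y) has_real_derivative g1 x y) (at x)"
    and 12: "\<And>x y. ((\<lambda>s. g1 x s) has_real_derivative g12 x y) (at y)"
    and 2: "\<And>x y. ((\<lambda>s. g x s) has_real_derivative g2 x y) (at y)"
    and 21: "\<And>x y. ((\<lambda>s. g2 s y) has_real_derivative g21 x y) (at x)"
    and c12: "continuous_on UNIV (\<lambda>(x, y). g12 x y)"
    and c21: "continuous_on UNIV (\<lambda>(x, y). g21 x y)"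
  shows "g12 a b = g21 a b"
proof (rule ccontr)
  assume ne: "g12 a b \<noteq> g21 a b"
  define e where "e = \<bar>g12 a b - g21 a b\<bar> / 2"
  have e: "e > 0" using ne by (simp add: e_def)
  obtain h1 where h1: "h1 > 0" "\<forall>\<xi>\<in>{a..a + h1}. \<forall>\<eta>\<in>{b..b + h1}. dist (g12 \<xi> \<eta>) (g12 a b) < e"
    using continuous_on_corner[OF c12 e] by blast
  obtain h2 where h2: "h2 > 0" "\<forall>\<xi>\<in>{a..a + h2}. \<forall>\<eta>\<in>{b..b + h2}. dist (g21 \<xi> \<eta>) (g21 a b) < e"
    using continuous_on_corner[OF c21 e] by blast
  define h where "h = min h1 h2"
  have h: "h > 0" "h \<le> h1" "h \<le> h2" using h1 h2 by (auto simp: h_def)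
  obtain \<xi> \<eta> where p: "\<xi> \<in> {a..a + h}" "\<eta> \<in> {b..b + h}"
    "g (a + h) (b + h) - g (a + h) b - g a (b + h) + g a b = h * h * g12 \<xi> \<eta>"
    using second_difference_mvt[of g g1 g12 h h a b, OF 1 12] h by blast
  \<comment> \<open>The same mean value statement with the roles of the two variables
    exchanged.\<close>
  obtain \<eta>' \<xi>' where q: "\<eta>' \<in> {b..b + h}" "\<xi>' \<in> {a..a + h}"
    "g (a + h) (b + h) - g a (b + h) - g (a + h) b + g a b = h * h * g21 \<xi>' \<eta>'"
    using second_difference_mvt[of "\<lambda>y x. g x y" "\<lambda>y x. g2 x y" "\<lambda>y x. g21 x y" h h b a, OF 2 21] h
    by blast
  have "h * h * g12 \<xi> \<eta> = h * h * g21 \<xi>' \<eta>'" using p(3) q(3) by linarith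
  then have "g12 \<xi> \<eta> = g21 \<xi>' \<eta>'" using h by simp
  moreover have "dist (g12 \<xi> \<eta>) (g12 a b) < e" using h1(2) p h by auto
  moreover have "dist (g21 \<xi>' \<eta>') (g21 a b) < e" using h2(2) q h by auto
  ultimately have "\<bar>g12 a b - g21 a b\<bar> < 2 * e" unfolding dist_real_def by linarith
  then show False by (simp add: e_def)
qed

lemma has_vector_derivative_Re_Im:
  assumes "(f has_vector_derivative f') F"
  shows "((\<lambda>x. Re (f x)) has_real_derivative Re f') F"
    and "((\<lambda>x. Im (f x)) has_real_derivative Im f') F"
  using bounded_linear.has_vector_derivative[OF bounded_linear_Re assms]
    bounded_linear.has_vector_derivative[OF bounded_linear_Im assms]
  by (simp_all add: has_real_derivative_iff_has_vector_derivative)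

lemma continuous_on_Re_Im_kernel:
  fixes g :: kernel
  assumes "continuous_on UNIV (\<lambda>(x, y). g x y)"
  shows "continuous_on UNIV (\<lambda>(x, y). Re (g x y))" "continuous_on UNIV (\<lambda>(x, y). Im (g x y))"
  using continuous_on_Re[OF assms] continuous_on_Im[OF assms] by (simp_all add: case_prod_unfold)

text \<open>Mean value points exist only for real functions, so real and imaginary parts are treated
  separately.\<close>

lemma mixed_derivatives_commute:
  fixes g :: kernel
  assumes 1: "\<And>x y. ((\<lambda>s. g s y) has_vector_derivative g1 x y) (at x)"
    and 12: "\<And>x y. ((\<lambda>s. g1 x s) has_vector_derivative g12 x y) (at y)"
    and 2: "\<And>x y. ((\<lambda>s. g x s) has_vector_derivative g2 x y) (at y)"
    and 21: "\<And>x y. ((\<lambda>s. g2 s y) has_vector_derivative g21 x y) (at x)"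
    and c12: "continuous_on UNIV (\<lambda>(x, y). g12 x y)"
    and c21: "continuous_on UNIV (\<lambda>(x, y). g21 x y)"
  shows "g12 = g21"
proof (intro ext complex_eqI)
  fix a b
  show "Re (g12 a b) = Re (g21 a b)"
    by (rule mixed_derivatives_commute_real[of "\<lambda>x y. Re (g x y)" "\<lambda>x y. Re (g1 x y)" _ "\<lambda>x y. Re (g2 x y)"])
      (intro has_vector_derivative_Re_Im continuous_on_Re_Im_kernel assms)+
  show "Im (g12 a b) = Im (g21 a b)"
    by (rule mixed_derivatives_commute_real[of "\<lambda>x y. Im (g x y)" "\<lambda>x y. Im (g1 x y)" _ "\<lambda>x y. Im (g2 x y)"])
      (intro has_vector_derivative_Re_Im continuous_on_Re_Im_kernel assms)+
qed

text \<open>Continuity of the second partial derivative makes the kernel totally differentiable; the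
  chain rule along \<open>t \<mapsto> (t, t)\<close> then adds the two partial derivatives.\<close>

lemma has_vector_derivative_diagonal:
  fixes g :: kernel
  assumes 1: "\<And>x y. ((\<lambda>s. g s y) has_vector_derivative g1 x y) (at x)"
    and 2: "\<And>x y. ((\<lambda>s. g x s) has_vector_derivative g2 x y) (at y)"
    and c2: "continuous_on UNIV (\<lambda>(x, y). g2 x y)"
  shows "((\<lambda>x. g x x) has_vector_derivative g1 x x + g2 x x) (at x)"
proof -
  have cont: "continuous (at (x, x)) (\<lambda>(x, y). blinfun_scaleR_left (g2 x y))"
    using c2 by (auto simp: continuous_on_eq_continuous_within case_prod_unfold
        intro!: bounded_linear.continuous[OF bounded_linear_blinfun_scaleR_left])
  have "((\<lambda>(x, y). g x y) has_derivative
      (\<lambda>(tx, ty). tx *\<^sub>R g1 x x + blinfun_scaleR_left (g2 x x) ty)) (at (x, x) within UNIV \<times> UNIV)"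
    by (rule has_derivative_partialsI)
      (use 1 2 cont in \<open>auto simp: has_vector_derivative_def\<close>)
  then have "((\<lambda>(x, y). g x y) has_derivative (\<lambda>(tx, ty). tx *\<^sub>R g1 x x + ty *\<^sub>R g2 x x)) (at (x, x))"
    by simp
  moreover have "((\<lambda>t. (t, t)) has_derivative (\<lambda>t. (t, t))) (at x)"
    by (auto intro!: derivative_eq_intros)
  ultimately have "((\<lambda>(x, y). g x y) \<circ> (\<lambda>t. (t, t)) has_derivative
     (\<lambda>(tx, ty). tx *\<^sub>R g1 x x + ty *\<^sub>R g2 x x) \<circ> (\<lambda>t. (t, t))) (at x)"
    by (rule diff_chain_at[rotated])
  then show ?thesis by (simp add: has_vector_derivative_def o_def scaleR_add_right)
qed

subsection \<open>Diagonal positivity of density kernels\<close>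

lemma
  fixes g :: "real \<Rightarrow> complex"
  assumes "continuous_on UNIV g"
  shows integrable_indicator_continuous: "integrable lborel (\<lambda>x. of_real (indicator {a..b} x) * g x)"
    and integral_indicator_continuous:
      "(LINT x|lborel. of_real (indicator {a..b} x) * g x) = integral {a..b} g"
proof -
  have s: "set_integrable lborel {a..b} g"
    by (intro borel_integrable_atLeastAtMost' continuous_on_subset[OF assms]) auto
  show "integrable lborel (\<lambda>x. of_real (indicator {a..b} x) * g x)"
    using s by (simp add: set_integrable_def scaleR_conv_of_real)
  show "(LINT x|lborel. of_real (indicator {a..b} x) * g x) = integral {a..b} g"
    using set_borel_integral_eq_integral(2)[OF s]
    by (simp add: set_lebesgue_integral_def scaleR_conv_of_real)
qed

lemma continuous_on_section:
  fixes \<kappa> :: kernel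
  assumes "continuous_on UNIV (\<lambda>(x, y). \<kappa> x y)"
  shows "continuous_on A (\<lambda>y. \<kappa> x y)"
proof -
  have "continuous_on A ((\<lambda>(x, y). \<kappa> x y) \<circ> (\<lambda>y. (x, y)))"
    by (intro continuous_on_compose continuous_on_subset[OF assms] continuous_intros) auto
  then show ?thesis by (simp add: o_def)
qed

lemma continuous_on_section_integral:
  fixes \<kappa> :: kernel
  assumes "continuous_on UNIV (\<lambda>(x, y). \<kappa> x y)"
  shows "continuous_on A (\<lambda>x. integral {a..b} (\<kappa> x))"
  using integral_continuous_on_param[of A a b \<kappa>] continuous_on_subset[OF assms, of "A \<times> {a..b}"]
  by simp

lemma norm_integral_diff_const_le:
  fixes f :: "real \<Rightarrow> complex"
  assumes f: "continuous_on {a..a + h} f" and h: "h > 0"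
    and bd: "\<And>x. x \<in> {a..a + h} \<Longrightarrow> norm (f x - c) \<le> e"
  shows "norm (integral {a..a + h} f - of_real h * c) \<le> e * h"
proof -
  have "integral {a..a + h} f - of_real h * c = integral {a..a + h} (\<lambda>x. f x - c)"
    using h f by (subst integral_diff) (auto intro: integrable_continuous_real simp: scaleR_conv_of_real)
  also have "norm \<dots> \<le> e * (a + h - a)"
    using h bd f by (intro integral_bound continuous_intros) auto
  finally show ?thesis by simp
qed

text \<open>The comparison with a constant is made twice: each inner integral is within
  \<open>e / 2 * h\<close> of \<open>of_real h * \<kappa> a b\<close>, so the outer one is within
  \<open>e / 2 * h * h\<close> of \<open>h\<^sup>2\<close> times the corner value.\<close>

lemma box_average_tendsto:
  fixes \<kappa> :: kernel
  assumes c: "continuous_on UNIV (\<lambda>(x, y). \<kappa> x y)"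
  shows "((\<lambda>h. integral {a..a + h} (\<lambda>x. integral {b..b + h} (\<kappa> x)) / of_real (h\<^sup>2)) \<longlongrightarrow> \<kappa> a b)
    (at_right 0)"
proof (rule tendstoI)
  fix e :: real assume "e > 0"
  then have "e / 2 > 0" by simp
  from continuous_on_corner[OF c this, of a b] obtain d where d: "d > 0"
    "\<And>\<xi> \<eta>. \<xi> \<in> {a..a + d} \<Longrightarrow> \<eta> \<in> {b..b + d} \<Longrightarrow> dist (\<kappa> \<xi> \<eta>) (\<kappa> a b) < e / 2"
    by blast
  have "dist (integral {a..a + h} (\<lambda>x. integral {b..b + h} (\<kappa> x)) / of_real (h\<^sup>2)) (\<kappa> a b) < e"
    if h: "0 < h" "h < d" for h
  proof -
    have "norm (integral {b..b + h} (\<kappa> x) - of_real h * \<kappa> a b) \<le> e / 2 * h" if "x \<in> {a..a + h}" for x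
    proof (rule norm_integral_diff_const_le)
      show "continuous_on {b..b + h} (\<kappa> x)" by (rule continuous_on_section[OF c])
      show "norm (\<kappa> x y - \<kappa> a b) \<le> e / 2" if "y \<in> {b..b + h}" for y
        using d(2)[of x y] that \<open>x \<in> {a..a + h}\<close> h by (simp add: dist_norm)
    qed (use h in auto)
    then have "norm (integral {a..a + h} (\<lambda>x. integral {b..b + h} (\<kappa> x))
        - of_real h * (of_real h * \<kappa> a b)) \<le> e / 2 * h * h"
      using norm_integral_diff_const_le[OF continuous_on_section_integral[OF c] h(1)] by blast
    then have "norm (integral {a..a + h} (\<lambda>x. integral {b..b + h} (\<kappa> x))
        - of_real (h\<^sup>2) * \<kappa> a b) / h\<^sup>2 \<le> e / 2"
      using h by (simp add: field_simps power2_eq_square)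
    also have "norm (integral {a..a + h} (\<lambda>x. integral {b..b + h} (\<kappa> x))
        - of_real (h\<^sup>2) * \<kappa> a b) / h\<^sup>2
      = norm ((integral {a..a + h} (\<lambda>x. integral {b..b + h} (\<kappa> x)) - of_real (h\<^sup>2) * \<kappa> a b)
          / of_real (h\<^sup>2))"
      using h by (simp only: norm_divide norm_of_real) simp
    also have "\<dots> = dist (integral {a..a + h} (\<lambda>x. integral {b..b + h} (\<kappa> x)) / of_real (h\<^sup>2)) (\<kappa> a b)"
      using h by (simp add: dist_norm diff_divide_distrib)
    finally show ?thesis using \<open>e > 0\<close> by simp
  qed
  then show "\<forall>\<^sub>F h in at_right 0.
      dist (integral {a..a + h} (\<lambda>x. integral {b..b + h} (\<kappa> x)) / of_real (h\<^sup>2)) (\<kappa> a b) < e"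
    using d(1) by (auto simp: eventually_at_right_field)
qed

text \<open>Testing positivity against combinations of indicators of \<open>[a, a + h]\<close> and \<open>[b, b + h]\<close>,
  as \<open>h \<rightarrow> 0\<close>.\<close>

lemma density_kernel_two_point:
  fixes \<kappa> :: kernel and c d :: real
  assumes dens: "density_kernel \<kappa>" and c: "continuous_on UNIV (\<lambda>(x, y). \<kappa> x y)"
  shows "0 \<le> Re (of_real (c * c) * \<kappa> a a + of_real (c * d) * \<kappa> a b
    + of_real (c * d) * \<kappa> b a + of_real (d * d) * \<kappa> b b)"
proof -
  define J where "J v h x = integral {v..v + h} (\<kappa> x)" for v h x
  define B where "B u v h = integral {u..u + h} (J v h)" for u v h
  have J: "continuous_on UNIV (J v h)" for v h
    unfolding J_def by (rule continuous_on_section_integral[OF c])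
  define Q where "Q h = of_real (c * c) * B a a h + of_real (c * d) * B a b h
    + of_real (c * d) * B b a h + of_real (d * d) * B b b h" for h
  have "0 \<le> Re (Q h)" for h
  proof -
    define \<psi> :: wave where
      "\<psi> x = of_real (c * indicator {a..a + h} x + d * indicator {b..b + h} x)" for x
    have sq: "square_integrable \<psi>"
      unfolding square_integrable_def
    proof
      show [measurable]: "\<psi> \<in> borel_measurable borel"
        unfolding \<psi>_def by measurable
      \<comment> \<open>The expanded square; the two intervals may overlap, and the product of their
        indicators is that of the intersection.\<close>
      have "integrable lborel (\<lambda>x. c\<^sup>2 * indicat_real {a..a + h} x
          + 2 * c * d * indicat_real ({a..a + h} \<inter> {b..b + h}) x + d\<^sup>2 * indicat_real {b..b + h} x)"
        by (intro Bochner_Integration.integrable_add integrable_mult_right integrable_real_indicator)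
          (auto simp: emeasure_lborel_Icc_eq)
      also have "(\<lambda>x. c\<^sup>2 * indicat_real {a..a + h} x
          + 2 * c * d * indicat_real ({a..a + h} \<inter> {b..b + h}) x + d\<^sup>2 * indicat_real {b..b + h} x)
        = (\<lambda>x. (cmod (\<psi> x))\<^sup>2)"
        unfolding \<psi>_def norm_of_real power2_abs
        by (rule ext) (auto simp: indicator_def power2_eq_square algebra_simps)
      finally show "integrable lborel (\<lambda>x. (cmod (\<psi> x))\<^sup>2)" .
    qed
    have inner: "(LINT y|lborel. \<kappa> x y * \<psi> y) = of_real c * J a h x + of_real d * J b h x" for x
    proof -
      have "(LINT y|lborel. \<kappa> x y * \<psi> y)
        = (LINT y|lborel. of_real c * (of_real (indicator {a..a + h} y) * \<kappa> x y)
            + of_real d * (of_real (indicator {b..b + h} y) * \<kappa> x y))"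
        by (intro Bochner_Integration.integral_cong) (auto simp: \<psi>_def algebra_simps)
      also have "\<dots> = of_real c * J a h x + of_real d * J b h x"
        using integrable_indicator_continuous[OF continuous_on_section[OF c]]
          integral_indicator_continuous[OF continuous_on_section[OF c]]
        by (subst Bochner_Integration.integral_add) (auto simp: J_def)
      finally show ?thesis .
    qed
    have "(LINT x|lborel. cnj (\<psi> x) * (LINT y|lborel. \<kappa> x y * \<psi> y))
      = (LINT x|lborel. of_real (c * c) * (of_real (indicator {a..a + h} x) * J a h x)
          + of_real (c * d) * (of_real (indicator {a..a + h} x) * J b h x)
          + of_real (c * d) * (of_real (indicator {b..b + h} x) * J a h x)
          + of_real (d * d) * (of_real (indicator {b..b + h} x) * J b h x))"
      unfolding inner by (intro Bochner_Integration.integral_cong) (auto simp: \<psi>_def algebra_simps)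
    also have "\<dots> = Q h"
      using integrable_indicator_continuous[OF J] integral_indicator_continuous[OF J]
      by (simp add: Q_def B_def)
    finally have "(LINT x|lborel. cnj (\<psi> x) * (LINT y|lborel. \<kappa> x y * \<psi> y)) = Q h" .
    moreover have "0 \<le> Re (LINT x|lborel. cnj (\<psi> x) * (LINT y|lborel. \<kappa> x y * \<psi> y))"
      using dens sq unfolding density_kernel_def by blast
    ultimately show ?thesis by simp
  qed
  then have nonneg: "0 \<le> Re (Q h / of_real (h\<^sup>2))" for h
    by (simp only: Re_divide_of_real) simp
  have "((\<lambda>h. Q h / of_real (h\<^sup>2)) \<longlongrightarrow> of_real (c * c) * \<kappa> a a + of_real (c * d) * \<kappa> a b
    + of_real (c * d) * \<kappa> b a + of_real (d * d) * \<kappa> b b) (at_right 0)"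
    unfolding Q_def add_divide_distrib times_divide_eq_right[symmetric]
    unfolding B_def J_def by (intro tendsto_add tendsto_mult_left box_average_tendsto c)
  then have "((\<lambda>h. Re (Q h / of_real (h\<^sup>2))) \<longlongrightarrow> Re (of_real (c * c) * \<kappa> a a + of_real (c * d) * \<kappa> a b
    + of_real (c * d) * \<kappa> b a + of_real (d * d) * \<kappa> b b)) (at_right 0)"
    by (rule tendsto_Re)
  then show ?thesis
    by (rule tendsto_lowerbound) (use nonneg in auto)
qed

lemma density_kernel_diagonal_nonneg:
  assumes "density_kernel \<kappa>" and "continuous_on UNIV (\<lambda>(x, y). \<kappa> x y)"
  shows "0 \<le> Re (\<kappa> a a)"
  using density_kernel_two_point[OF assms, where c = 1 and d = 0] by simp

text \<open>\<open>\<kappa>12 a a\<close> is a limit of second differences of \<open>\<kappa>\<close>, which are the two-point forms with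
  coefficients \<open>1\<close> and \<open>-1\<close>.\<close>

lemma density_kernel_momentum_nonneg:
  assumes dens: "density_kernel \<kappa>" and c: "continuous_on UNIV (\<lambda>(x, y). \<kappa> x y)"
    and 1: "\<And>x y. ((\<lambda>s. \<kappa> s y) has_vector_derivative \<kappa>1 x y) (at x)"
    and 12: "\<And>x y. ((\<lambda>s. \<kappa>1 x s) has_vector_derivative \<kappa>12 x y) (at y)"
    and c12: "continuous_on UNIV (\<lambda>(x, y). \<kappa>12 x y)"
  shows "0 \<le> Re (\<kappa>12 a a)"
proof (rule ccontr)
  assume neg: "\<not> 0 \<le> Re (\<kappa>12 a a)"
  then have "- Re (\<kappa>12 a a) > 0" by simp
  \<comment> \<open>With tolerance \<open>- Re (\<kappa>12 a a)\<close>, the real part of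
    \<open>\<kappa>12\<close> stays negative on the whole square.\<close>
  from continuous_on_corner[OF continuous_on_Re_Im_kernel(1)[OF c12] this, of a a]
  obtain h where h: "h > 0" "\<And>\<xi> \<eta>. \<xi> \<in> {a..a + h} \<Longrightarrow> \<eta> \<in> {a..a + h} \<Longrightarrow>
      dist (Re (\<kappa>12 \<xi> \<eta>)) (Re (\<kappa>12 a a)) < - Re (\<kappa>12 a a)"
    by blast
  obtain \<xi> \<eta> where p: "\<xi> \<in> {a..a + h}" "\<eta> \<in> {a..a + h}"
    "Re (\<kappa> (a + h) (a + h)) - Re (\<kappa> (a + h) a) - Re (\<kappa> a (a + h)) + Re (\<kappa> a a)
      = h * h * Re (\<kappa>12 \<xi> \<eta>)"
    using second_difference_mvt[of "\<lambda>x y. Re (\<kappa> x y)" "\<lambda>x y. Re (\<kappa>1 x y)" "\<lambda>x y. Re (\<kappa>12 x y)" h h a a,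
        OF has_vector_derivative_Re_Im(1)[OF 1] has_vector_derivative_Re_Im(1)[OF 12]] h(1)
    by blast
  have "Re (\<kappa>12 \<xi> \<eta>) < 0" using h(2)[OF p(1,2)] by (simp add: dist_real_def abs_if split: if_splits)
  then have "h * h * Re (\<kappa>12 \<xi> \<eta>) < 0" using h(1) by (simp add: mult_pos_neg)
  moreover have "0 \<le> Re (\<kappa> (a + h) (a + h)) - Re (\<kappa> (a + h) a) - Re (\<kappa> a (a + h)) + Re (\<kappa> a a)"
    using density_kernel_two_point[OF dens c, where a = "a + h" and b = a and c = 1 and d = "-1"] by simp
  ultimately show False using p(3) by simp
qed

subsection \<open>Partial derivatives of kernels and the Lindbladian\<close>

definition partial1 :: "kernel \<Rightarrow> kernel" where
  "partial1 g = (\<lambda>x y. vector_derivative (\<lambda>s. g s y) (at x))"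

definition partial2 :: "kernel \<Rightarrow> kernel" where
  "partial2 g = (\<lambda>x y. vector_derivative (\<lambda>s. g x s) (at y))"

lemma smooth_kernel_continuous:
  "smooth_kernel n g \<Longrightarrow> continuous_on UNIV (\<lambda>(x, y). g x y)"
  by (cases n) auto

lemma smooth_kernel_Suc:
  assumes "smooth_kernel (Suc n) g"
  shows "smooth_kernel n (partial1 g)" "smooth_kernel n (partial2 g)"
    "((\<lambda>s. g s y) has_vector_derivative partial1 g x y) (at x)"
    "((\<lambda>s. g x s) has_vector_derivative partial2 g x y) (at y)"
  using assms by (auto simp: partial1_def partial2_def vector_derivative_works)

lemma smooth_kernel_mono:
  assumes "smooth_kernel N g" and "n \<le> N"
  shows "smooth_kernel n g"
  using assms
proof (induction n arbitrary: N g)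
  case 0
  then show ?case using smooth_kernel_continuous[of N g] by simp
next
  case (Suc n)
  then obtain M where "N = Suc M" "n \<le> M" by (cases N) auto
  then show ?case using Suc.prems Suc.IH[of M] by simp
qed

lemma partials_commute:
  assumes "smooth_kernel (Suc (Suc n)) g"
  shows "partial2 (partial1 g) = partial1 (partial2 g)"
proof -
  have 1: "smooth_kernel (Suc n) (partial1 g)" and 2: "smooth_kernel (Suc n) (partial2 g)"
    using smooth_kernel_Suc[OF assms] by auto
  show ?thesis
    by (rule mixed_derivatives_commute)
      (rule smooth_kernel_Suc(3,4)[OF assms] smooth_kernel_Suc(3,4)[OF 1] smooth_kernel_Suc(3,4)[OF 2]
        smooth_kernel_continuous[OF smooth_kernel_Suc(2)[OF 1]]
        smooth_kernel_continuous[OF smooth_kernel_Suc(1)[OF 2]])+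
qed

section \<open>Iterated partial derivatives\<close>

lemma smooth_kernel_funpow:
  assumes "smooth_kernel (a + n) g"
  shows "smooth_kernel n ((partial1 ^^ a) g)" "smooth_kernel n ((partial2 ^^ a) g)"
  using assms
proof (induction a arbitrary: n)
  case (Suc a)
  { case 1
    then show ?case using Suc.IH(1)[of "Suc n"] smooth_kernel_Suc(1) by simp }
  { case 2
    then show ?case using Suc.IH(2)[of "Suc n"] smooth_kernel_Suc(2) by simp }
qed auto

lemma partial2_partial1_funpow:
  assumes "smooth_kernel (Suc (a + n)) g"
  shows "partial2 ((partial1 ^^ a) g) = (partial1 ^^ a) (partial2 g)"
  using assms
proof (induction a arbitrary: n)
  case (Suc a)
  have "smooth_kernel (a + Suc (Suc n)) g" using Suc.prems by simp
  then have "smooth_kernel (Suc (Suc n)) ((partial1 ^^ a) g)" by (rule smooth_kernel_funpow)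
  then have "partial2 (partial1 ((partial1 ^^ a) g)) = partial1 (partial2 ((partial1 ^^ a) g))"
    by (rule partials_commute)
  then show ?case using Suc.IH[of "Suc n"] Suc.prems by simp
qed simp

text \<open>A normal form: derivatives in the second variable are taken first. Symmetry of mixed
  derivatives lets the pair \<open>a\<close>, \<open>b\<close> index every mixed derivative within
  the available smoothness, whatever the order of differentiation.\<close>

definition partials :: "kernel \<Rightarrow> nat \<Rightarrow> nat \<Rightarrow> kernel" where
  "partials g a b = (partial1 ^^ a) ((partial2 ^^ b) g)"

lemma partials_0 [simp]: "partials g 0 0 = g"
  by (simp add: partials_def)

lemma smooth_kernel_partials:
  assumes "smooth_kernel N g" and "a + b + n = N"
  shows "smooth_kernel n (partials g a b)"
  unfolding partials_def
  by (intro smooth_kernel_funpow) (use assms in \<open>simp add: ac_simps\<close>)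

lemma
  assumes g: "smooth_kernel N g" and ab: "a + b < N"
  shows has_vector_derivative_partials1:
      "((\<lambda>s. partials g a b s y) has_vector_derivative partials g (Suc a) b x y) (at x)"
    and has_vector_derivative_partials2:
      "((\<lambda>s. partials g a b x s) has_vector_derivative partials g a (Suc b) x y) (at y)"
proof -
  \<comment> \<open>The order of smoothness left after one further derivative.\<close>
  define n where "n = N - Suc (a + b)"
  have n: "a + b + Suc n = N" using ab by (simp add: n_def)
  have s: "smooth_kernel (Suc n) (partials g a b)"
    by (rule smooth_kernel_partials[OF g n])
  show "((\<lambda>s. partials g a b s y) has_vector_derivative partials g (Suc a) b x y) (at x)"
    using smooth_kernel_Suc(3)[OF s] by (simp add: partials_def)
  have "smooth_kernel (Suc (a + n)) ((partial2 ^^ b) g)"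
    by (intro smooth_kernel_funpow) (use g n in \<open>simp add: ac_simps\<close>)
  then have "partial2 (partials g a b) = partials g a (Suc b)"
    using partial2_partial1_funpow by (simp add: partials_def)
  then show "((\<lambda>s. partials g a b x s) has_vector_derivative partials g a (Suc b) x y) (at y)"
    using smooth_kernel_Suc(4)[OF s] by metis
qed

lemma continuous_on_partials:
  assumes "smooth_kernel N g" and "a + b \<le> N"
  shows "continuous_on UNIV (\<lambda>(x, y). partials g a b x y)"
  using smooth_kernel_continuous[OF smooth_kernel_partials[OF assms(1), of a b "N - (a + b)"]] assms(2)
  by simp

lemma has_vector_derivative_partials_diagonal:
  assumes "smooth_kernel N g" and "a + b < N"
  shows "((\<lambda>x. partials g a b x x) has_vector_derivative
    partials g (Suc a) b x x + partials g a (Suc b) x x) (at x)"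
  using assms
  by (intro has_vector_derivative_diagonal has_vector_derivative_partials1
      has_vector_derivative_partials2 continuous_on_partials) auto


section \<open>The operators as differential operators on kernels\<close>

lemma rmul_adj_apply: "rmul_adj A \<tau> x y = cnj (A (\<lambda>s. cnj (\<tau> x s)) y)"
  by (simp add: rmul_adj_def kernel_adj_def lmul_def)

lemma imaginary_unit_mult_both: "\<i> * a * (\<i> * b) = - (a * b)"
proof -
  have "\<i> * a * (\<i> * b) = (\<i> * \<i>) * (a * b)" by (simp only: ac_simps)
  then show ?thesis by simp
qed

lemma momentum_op_apply:
  "(\<psi> has_vector_derivative d) (at x) \<Longrightarrow> momentum_op hbar \<psi> x = - \<i> * of_real hbar * d"
  by (simp add: momentum_op_def vector_derivative_at)

lemma rmul_adj_momentum_apply: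
  assumes "(\<tau> x has_vector_derivative d) (at y)"
  shows "rmul_adj (momentum_op hbar) \<tau> x y = \<i> * of_real hbar * d"
  using momentum_op_apply[OF has_vector_derivative_cnj[OF assms], of hbar] by (simp add: rmul_adj_apply)

lemma hamiltonian_apply:
  assumes 1: "\<And>x. (\<psi> has_vector_derivative \<psi>' x) (at x)"
    and 2: "(\<psi>' has_vector_derivative d) (at x)"
  shows "hamiltonian hbar m V \<psi> x = - of_real (hbar\<^sup>2 / (2 * m)) * d + of_real (V x) * \<psi> x"
proof -
  have "momentum_op hbar \<psi> = (\<lambda>x. - \<i> * of_real hbar * \<psi>' x)"
    using momentum_op_apply[OF 1] by blast
  moreover have "((\<lambda>x. - \<i> * of_real hbar * \<psi>' x) has_vector_derivative - \<i> * of_real hbar * d) (at x)"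
    by (intro has_vector_derivative_mult_right 2)
  ultimately show ?thesis
    using momentum_op_apply
    by (simp add: hamiltonian_def mult_op_def power2_eq_square imaginary_unit_mult_both mult.assoc[of \<i> _ d])
qed

lemma rmul_adj_hamiltonian_apply:
  assumes 1: "\<And>y. (\<tau> x has_vector_derivative \<tau>' y) (at y)"
    and 2: "(\<tau>' has_vector_derivative d) (at y)"
  shows "rmul_adj (hamiltonian hbar m V) \<tau> x y
    = - of_real (hbar\<^sup>2 / (2 * m)) * d + of_real (V y) * \<tau> x y"
  using hamiltonian_apply[OF has_vector_derivative_cnj[OF 1] has_vector_derivative_cnj[OF 2], of hbar m V]
  by (simp add: rmul_adj_apply)

lemma jump_op_apply:
  assumes "(\<psi> has_vector_derivative d) (at x)"
  shows "jump_op hbar \<mu> \<nu> \<psi> x = of_real \<mu> * of_real x * \<psi> x + of_real (\<nu> * hbar) * d"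
    and "jump_adj_op hbar \<mu> \<nu> \<psi> x = of_real \<mu> * of_real x * \<psi> x - of_real (\<nu> * hbar) * d"
  by (simp_all add: jump_op_def jump_adj_op_def position_op_def mult_op_def momentum_op_apply[OF assms]
      imaginary_unit_mult_both mult.assoc[of \<i> _ d])

text \<open>The cross terms \<open>x * \<psi>'\<close> cancel; the term with
  \<open>\<mu> * \<nu> * hbar\<close> is what the commutator of position and momentum
  leaves.\<close>

lemma jump_number_op_apply:
  assumes 1: "\<And>x. (\<psi> has_vector_derivative \<psi>' x) (at x)"
    and 2: "(\<psi>' has_vector_derivative d) (at x)"
  shows "jump_adj_op hbar \<mu> \<nu> (jump_op hbar \<mu> \<nu> \<psi>) x
    = of_real (\<mu>\<^sup>2 * x\<^sup>2) * \<psi> x - of_real (\<mu> * \<nu> * hbar) * \<psi> x - of_real (\<nu>\<^sup>2 * hbar\<^sup>2) * d"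
proof -
  have L: "jump_op hbar \<mu> \<nu> \<psi> = (\<lambda>x. of_real \<mu> * of_real x * \<psi> x + of_real (\<nu> * hbar) * \<psi>' x)"
    using jump_op_apply(1)[OF 1] by blast
  have "((\<lambda>x. of_real \<mu> * of_real x * \<psi> x + of_real (\<nu> * hbar) * \<psi>' x) has_vector_derivative
      of_real \<mu> * of_real x * \<psi>' x + of_real \<mu> * \<psi> x + of_real (\<nu> * hbar) * d) (at x)"
    by (auto intro!: derivative_eq_intros 1 2)
  then show ?thesis
    unfolding L by (subst jump_op_apply(2)) (auto simp: algebra_simps power2_eq_square)
qed

lemma rmul_adj_jump_op_apply:
  assumes "(\<tau> x has_vector_derivative d) (at y)"
  shows "rmul_adj (jump_op hbar \<mu> \<nu>) \<tau> x y = of_real \<mu> * of_real y * \<tau> x y + of_real (\<nu> * hbar) * d"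
  using jump_op_apply(1)[OF has_vector_derivative_cnj[OF assms], of hbar \<mu> \<nu>]
  by (simp add: rmul_adj_apply)

text \<open>The quadratic position terms complete the square of \<open>x - y\<close>, which vanishes
  on the diagonal, and the second derivatives with coefficient
  \<open>\<nu>\<^sup>2 * hbar\<^sup>2\<close> form the square of the sum of the two partial
  derivatives, the derivative along the diagonal direction.\<close>

lemma lindbladian_apply:
  fixes V :: "real \<Rightarrow> real" and hbar m \<Omega> kB T \<eta> :: real
  assumes s: "smooth_kernel 2 \<kappa>" and "hbar \<noteq> 0" and "m \<noteq> 0"
  defines "k \<equiv> partials \<kappa>"
    and "\<mu> \<equiv> qld_mu hbar m \<Omega> kB T \<eta>" and "\<nu> \<equiv> qld_nu hbar m \<Omega> kB T \<eta>"
  shows "lindbladian hbar m \<Omega> kB T \<eta> V \<kappa> x y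
    = \<i> * of_real (hbar / (2 * m)) * (k 2 0 x y - k 0 2 x y)
      - \<i> / of_real hbar * (of_real (V x) - of_real (V y)) * k 0 0 x y
      - of_real (\<mu>\<^sup>2) * (of_real x - of_real y)\<^sup>2 * k 0 0 x y
      + of_real (2 * \<mu> * \<nu> * hbar) * (of_real x * k 0 1 x y + of_real y * k 1 0 x y + k 0 0 x y)
      + of_real (\<nu>\<^sup>2 * hbar\<^sup>2) * (k 2 0 x y + 2 * k 1 1 x y + k 0 2 x y)"
proof -
  have D1: "((\<lambda>s. k a b s y) has_vector_derivative k (Suc a) b x y) (at x)" if "a + b < 2" for a b x y
    unfolding k_def by (rule has_vector_derivative_partials1[OF s that])
  have D2: "((\<lambda>s. k a b x s) has_vector_derivative k a (Suc b) x y) (at y)" if "a + b < 2" for a b x y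
    unfolding k_def by (rule has_vector_derivative_partials2[OF s that])
  have k0: "k 0 0 = \<kappa>" by (simp add: k_def)
  note D1' = D1[of 0 0, unfolded k0, simplified] D1[of 1 0, simplified] D1[of 0 1, simplified]
  note D2' = D2[of 0 0, unfolded k0, simplified] D2[of 0 1, simplified] D2[of 1 0, simplified]
  have H1: "lmul (hamiltonian hbar m V) \<kappa> x y
      = - of_real (hbar\<^sup>2 / (2 * m)) * k 2 0 x y + of_real (V x) * \<kappa> x y"
    unfolding lmul_def using D1'
    by (subst hamiltonian_apply) (auto simp: numeral_2_eq_2)
  have H2: "rmul_adj (hamiltonian hbar m V) \<kappa> x y
      = - of_real (hbar\<^sup>2 / (2 * m)) * k 0 2 x y + of_real (V y) * \<kappa> x y"
    using D2' by (subst rmul_adj_hamiltonian_apply) (auto simp: numeral_2_eq_2)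
  have R: "rmul_adj (jump_op hbar \<mu> \<nu>) \<kappa>
      = (\<lambda>x y. of_real \<mu> * of_real y * \<kappa> x y + of_real (\<nu> * hbar) * k 0 1 x y)"
    using rmul_adj_jump_op_apply D2'(1) by (intro ext) auto
  have LR: "lmul (jump_op hbar \<mu> \<nu>) (rmul_adj (jump_op hbar \<mu> \<nu>) \<kappa>) x y
      = of_real \<mu> * of_real x * (of_real \<mu> * of_real y * \<kappa> x y + of_real (\<nu> * hbar) * k 0 1 x y)
        + of_real (\<nu> * hbar) * (of_real \<mu> * of_real y * k 1 0 x y + of_real (\<nu> * hbar) * k 1 1 x y)"
    unfolding lmul_def R
    by (rule jump_op_apply(1)) (use D1' in \<open>auto intro!: derivative_eq_intros\<close>)
  have N1: "lmul (jump_adj_op hbar \<mu> \<nu> \<circ> jump_op hbar \<mu> \<nu>) \<kappa> x y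
      = of_real (\<mu>\<^sup>2 * x\<^sup>2) * \<kappa> x y - of_real (\<mu> * \<nu> * hbar) * \<kappa> x y
        - of_real (\<nu>\<^sup>2 * hbar\<^sup>2) * k 2 0 x y"
    unfolding lmul_def o_def using D1'
    by (subst jump_number_op_apply) (auto simp: numeral_2_eq_2)
  have N2: "rmul_adj (jump_adj_op hbar \<mu> \<nu> \<circ> jump_op hbar \<mu> \<nu>) \<kappa> x y
      = of_real (\<mu>\<^sup>2 * y\<^sup>2) * \<kappa> x y - of_real (\<mu> * \<nu> * hbar) * \<kappa> x y
        - of_real (\<nu>\<^sup>2 * hbar\<^sup>2) * k 0 2 x y"
    unfolding rmul_adj_apply o_def
    by (subst jump_number_op_apply[OF has_vector_derivative_cnj[OF D2'(1)] has_vector_derivative_cnj[OF D2'(2)]])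
      (auto simp: numeral_2_eq_2)
  show ?thesis
    unfolding lindbladian_def Let_def \<mu>_def[symmetric] \<nu>_def[symmetric] H1 H2 LR N1 N2 k0
    using assms(2,3) by (simp add: field_simps power2_eq_square)
qed

subsection \<open>Moments\<close>

text \<open>The state at one fixed time: \<open>\<kappa>\<close> stands for \<open>\<rho> t\<close>,
  so that the energy balance is a statement about a single kernel.\<close>

locale moment_state =
  fixes hbar m :: real and V V' V'' :: "real \<Rightarrow> real" and \<kappa> :: kernel
  assumes hbar: "hbar > 0" and m: "m > 0"
    and V: "\<And>x. (V has_real_derivative V' x) (at x)"
    and V': "\<And>x. (V' has_real_derivative V'' x) (at x)"
    and smooth: "smooth_kernel 4 \<kappa>"
    and density: "density_kernel \<kappa>"
    and moments: "\<And>n \<tau>. n \<le> 4 \<Longrightarrow> moment_kernel hbar V \<kappa> n \<tau> \<Longrightarrow> integrable lborel (\<lambda>x. \<tau> x x)"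
begin

abbreviation k :: "nat \<Rightarrow> nat \<Rightarrow> kernel" where "k \<equiv> partials \<kappa>"

lemmas D1 = has_vector_derivative_partials1[OF smooth]
lemmas D2 = has_vector_derivative_partials2[OF smooth]
lemmas D_diag = has_vector_derivative_partials_diagonal[OF smooth]

text \<open>The constant \<open>c\<close> absorbs the powers of \<open>\<plusminus> \<i> \<hbar>\<close> in the momentum operators.\<close>

definition moment :: "nat \<Rightarrow> kernel \<Rightarrow> bool" where
  "moment n \<tau> \<longleftrightarrow> (\<exists>c\<noteq>0. moment_kernel hbar V \<kappa> n (\<lambda>x y. c * \<tau> x y))"

lemma moment_integrable:
  assumes "moment n \<tau>" and "n \<le> 4"
  shows "integrable lborel (\<lambda>x. \<tau> x x)"
proof -
  obtain c where c: "c \<noteq> 0" "moment_kernel hbar V \<kappa> n (\<lambda>x y. c * \<tau> x y)"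
    using assms(1) by (auto simp: moment_def)
  from moments[OF assms(2) c(2)] have "integrable lborel (\<lambda>x. c * \<tau> x x)" .
  from integrable_mult_right[OF this, of "1 / c"] show ?thesis using c(1) by simp
qed

lemma moment_0: "moment 0 \<kappa>"
  unfolding moment_def using moment_kernel.base by (intro exI[of _ 1]) simp

lemma moment_position:
  assumes "moment n \<tau>"
  shows "moment (Suc n) (\<lambda>x y. of_real x * \<tau> x y)"
proof -
  obtain c where c: "c \<noteq> 0" "moment_kernel hbar V \<kappa> n (\<lambda>x y. c * \<tau> x y)"
    using assms by (auto simp: moment_def)
  from moment_kernel.x_left[OF c(2)]
  have "moment_kernel hbar V \<kappa> (Suc n) (\<lambda>x y. c * (of_real x * \<tau> x y))"
    by (simp add: lmul_def position_op_def mult_op_def mult.left_commute)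
  then show ?thesis using c(1) by (auto simp: moment_def)
qed

lemma moment_V:
  assumes "moment n \<tau>"
  shows "moment (Suc (Suc n)) (\<lambda>x y. of_real (V y) * \<tau> x y)"
proof -
  obtain c where c: "c \<noteq> 0" "moment_kernel hbar V \<kappa> n (\<lambda>x y. c * \<tau> x y)"
    using assms by (auto simp: moment_def)
  from moment_kernel.V_right[OF c(2)]
  have "moment_kernel hbar V \<kappa> (Suc (Suc n)) (\<lambda>x y. c * (of_real (V y) * \<tau> x y))"
    by (simp add: rmul_adj_apply[abs_def] mult_op_def mult.left_commute)
  then show ?thesis using c(1) by (auto simp: moment_def)
qed

text \<open>A derivative in the first variable is left multiplication by momentum up to the factor
  \<open>- \<i> * hbar\<close>, which is nonzero and goes into the constant.\<close>

lemma moment_partial1: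
  assumes "moment n \<tau>" and d: "\<And>x y. ((\<lambda>s. \<tau> s y) has_vector_derivative \<tau>' x y) (at x)"
  shows "moment (Suc n) \<tau>'"
proof -
  obtain c where c: "c \<noteq> 0" "moment_kernel hbar V \<kappa> n (\<lambda>x y. c * \<tau> x y)"
    using assms(1) by (auto simp: moment_def)
  have "lmul (momentum_op hbar) (\<lambda>x y. c * \<tau> x y) = (\<lambda>x y. (- \<i> * of_real hbar * c) * \<tau>' x y)"
    unfolding lmul_def using momentum_op_apply[OF has_vector_derivative_mult_right[OF d]]
    by (intro ext) (simp add: ac_simps)
  with moment_kernel.p_left[OF c(2)]
  have "moment_kernel hbar V \<kappa> (Suc n) (\<lambda>x y. (- \<i> * of_real hbar * c) * \<tau>' x y)"
    by simp
  then show ?thesis using c(1) hbar unfolding moment_def by (intro exI[of _ "- \<i> * of_real hbar * c"]) auto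
qed

lemma moment_partial2:
  assumes "moment n \<tau>" and d: "\<And>x y. ((\<lambda>s. \<tau> x s) has_vector_derivative \<tau>' x y) (at y)"
  shows "moment (Suc n) \<tau>'"
proof -
  obtain c where c: "c \<noteq> 0" "moment_kernel hbar V \<kappa> n (\<lambda>x y. c * \<tau> x y)"
    using assms(1) by (auto simp: moment_def)
  have "rmul_adj (momentum_op hbar) (\<lambda>x y. c * \<tau> x y) = (\<lambda>x y. (\<i> * of_real hbar * c) * \<tau>' x y)"
    using rmul_adj_momentum_apply[OF has_vector_derivative_mult_right[OF d]]
    by (intro ext) (simp add: ac_simps)
  with moment_kernel.p_right[OF c(2)]
  have "moment_kernel hbar V \<kappa> (Suc n) (\<lambda>x y. (\<i> * of_real hbar * c) * \<tau>' x y)"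
    by simp
  then show ?thesis using c(1) hbar unfolding moment_def by (intro exI[of _ "\<i> * of_real hbar * c"]) auto
qed

lemma moment_partials:
  assumes "a + b \<le> 4"
  shows "moment (a + b) (k a b)"
  using assms
proof (induction a)
  case 0
  then show ?case
  proof (induction b)
    case 0
    then show ?case by (simp add: moment_0)
  next
    case (Suc b)
    then show ?case using moment_partial2[OF _ D2[of 0 b]] by simp
  qed
next
  case (Suc a)
  then show ?case using moment_partial1[OF _ D1[of a b]] by simp
qed

section \<open>Integrability on the diagonal\<close>

lemma integrable_partials: "a + b \<le> 4 \<Longrightarrow> integrable lborel (\<lambda>x. k a b x x)"
  using moment_integrable moment_partials by blast

lemma integrable_x_partials: "a + b \<le> 3 \<Longrightarrow> integrable lborel (\<lambda>x. of_real x * k a b x x)"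
  using moment_integrable[OF moment_position[OF moment_partials[of a b]]] by simp

lemma integrable_V_partials: "a + b \<le> 2 \<Longrightarrow> integrable lborel (\<lambda>x. of_real (V x) * k a b x x)"
  using moment_integrable[OF moment_V[OF moment_partials[of a b]]] by simp

lemma integrable_x_V_partials:
  "a + b \<le> 1 \<Longrightarrow> integrable lborel (\<lambda>x. of_real x * (of_real (V x) * k a b x x))"
  using moment_integrable[OF moment_position[OF moment_V[OF moment_partials[of a b]]]] by simp

text \<open>Momentum applied from the right after \<open>V\<close> produces \<open>V'\<close> by the
  product rule. Subtracting the moment that contains \<open>V\<close> alone later isolates
  \<open>V'\<close>, which amounts to the commutator of \<open>p\<close> and
  \<open>V\<close>.\<close>

lemma moment_V_partial2:
  assumes "a + b \<le> 1"
  shows "moment (Suc (Suc (Suc (a + b)))) (\<lambda>x y. of_real (V y) * k a (Suc b) x y + of_real (V' y) * k a b x y)"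
proof (rule moment_partial2)
  show "moment (Suc (Suc (a + b))) (\<lambda>x y. of_real (V y) * k a b x y)"
    using assms by (intro moment_V moment_partials) auto
  show "((\<lambda>s. of_real (V s) * k a b x s) has_vector_derivative
      of_real (V y) * k a (Suc b) x y + of_real (V' y) * k a b x y) (at y)" for x y
    using assms by (intro derivative_intros D2 V) auto
qed

lemma integrable_V'_partials:
  assumes "a + b \<le> 1"
  shows "integrable lborel (\<lambda>x. of_real (V' x) * k a b x x)"
  using Bochner_Integration.integrable_diff[OF moment_integrable[OF moment_V_partial2[OF assms]]
      integrable_V_partials[of a "Suc b"]] assms
  by simp

lemma integrable_x_V': "integrable lborel (\<lambda>x. of_real x * (of_real (V' x) * k 0 0 x x))"
  using Bochner_Integration.integrable_diff[OF
      moment_integrable[OF moment_position[OF moment_V_partial2[of 0 0]]]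
      integrable_x_V_partials[of 0 1]]
  by (simp add: algebra_simps)

text \<open>One more momentum from the right brings the weight to exactly 4. By the Leibniz rule the
  result consists of \<open>V''\<close> and terms in \<open>V\<close> and \<open>V'\<close> already
  known to be integrable.\<close>

lemma integrable_V'': "integrable lborel (\<lambda>x. of_real (V'' x) * k 0 0 x x)"
proof -
  have "moment 4 (\<lambda>x y. of_real (V y) * k 0 2 x y + 2 * (of_real (V' y) * k 0 1 x y)
      + of_real (V'' y) * k 0 0 x y)"
    using D2[of 0 0] D2[of 0 1]
    by (intro moment_partial2[where n = 3 and \<tau> = "\<lambda>x y. of_real (V y) * k 0 (Suc 0) x y + of_real (V' y) * k 0 0 x y",
          simplified])
      (use moment_V_partial2[of 0 0] in \<open>auto intro!: derivative_eq_intros V V' simp: numeral_3_eq_3 numeral_2_eq_2 algebra_simps\<close>)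
  then have "integrable lborel (\<lambda>x. of_real (V x) * k 0 2 x x + 2 * (of_real (V' x) * k 0 1 x x)
      + of_real (V'' x) * k 0 0 x x)"
    by (rule moment_integrable) simp
  from Bochner_Integration.integrable_diff[OF this Bochner_Integration.integrable_add[OF integrable_V_partials[of 0 2]
      integrable_mult_right[OF integrable_V'_partials[of 0 1], of 2]]]
  show ?thesis by simp
qed

section \<open>Positivity and the kinetic energy\<close>

lemma diagonal_nonneg: "0 \<le> Re (k 0 0 x x)"
  using density_kernel_diagonal_nonneg[OF density smooth_kernel_continuous[OF smooth]] by simp

lemma momentum_nonneg: "0 \<le> Re (k 1 1 x x)"
  by (rule density_kernel_momentum_nonneg[OF density smooth_kernel_continuous[OF smooth],
        of "k 1 0" "k 1 1"])
    (use D1[of 0 0] D2[of 1 0] continuous_on_partials[OF smooth, of 1 1] in auto)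

lemma integral_diagonal: "(LINT x|lborel. k 0 0 x x) = 1"
  using density by (simp add: density_kernel_def kernel_trace_def)

lemma expectation_mult_op:
  assumes "integrable lborel (\<lambda>x. of_real (f x) * k 0 0 x x)"
  shows "expectation (mult_op f) \<kappa> = Re (LINT x|lborel. of_real (f x) * k 0 0 x x)"
  by (simp add: expectation_def kernel_trace_def rmul_adj_apply mult_op_def)

text \<open>Integration by parts along the diagonal, with \<open>k 0 1\<close> as primitive. It
  trades \<open>k 0 2\<close>, which the Hamiltonian produces, for \<open>k 1 1\<close>, whose
  diagonal has nonnegative real part.\<close>

lemma kinetic_integral: "(LINT x|lborel. k 0 2 x x) = - (LINT x|lborel. k 1 1 x x)"
proof -
  have "(LINT x|lborel. k 1 1 x x + k 0 2 x x) = 0"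
  proof (rule integral_derivative_eq_0)
    show "((\<lambda>x. k 0 1 x x) has_vector_derivative k 1 1 x x + k 0 2 x x) (at x)" for x
      using D_diag[of 0 1 x] by (simp add: numeral_2_eq_2)
  qed (auto intro!: integrable_partials)
  then show ?thesis
    by (simp add: integrable_partials eq_neg_iff_add_eq_0 add.commute)
qed

text \<open>The expectation of \<open>p\<^sup>2 / (2 * m)\<close>, written with the kernel of
  \<open>p \<kappa> p\<close>, which is \<open>hbar\<^sup>2\<close> times
  \<open>k 1 1\<close>.\<close>

definition kinetic :: real where
  "kinetic = hbar\<^sup>2 / (2 * m) * Re (LINT x|lborel. k 1 1 x x)"

lemma kinetic_nonneg: "0 \<le> kinetic"
proof -
  have "0 \<le> (LINT x|lborel. Re (k 1 1 x x))"
    using momentum_nonneg by (intro integral_nonneg_AE AE_I2) auto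
  then show ?thesis
    using m by (simp add: kinetic_def integrable_partials)
qed

lemma expectation_hamiltonian:
  "expectation (hamiltonian hbar m V) \<kappa> = kinetic + expectation (mult_op V) \<kappa>"
proof -
  have "rmul_adj (hamiltonian hbar m V) \<kappa> x x
      = - of_real (hbar\<^sup>2 / (2 * m)) * k 0 2 x x + of_real (V x) * k 0 0 x x" for x
    using D2[of 0 0] D2[of 0 1]
    by (subst rmul_adj_hamiltonian_apply) (auto simp: numeral_2_eq_2)
  then have "kernel_trace (rmul_adj (hamiltonian hbar m V) \<kappa>)
      = - of_real (hbar\<^sup>2 / (2 * m)) * (LINT x|lborel. k 0 2 x x)
        + (LINT x|lborel. of_real (V x) * k 0 0 x x)"
    using integrable_partials[of 0 2] integrable_V_partials[of 0 0]
    by (simp add: kernel_trace_def)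
  also have "\<dots> = of_real (hbar\<^sup>2 / (2 * m)) * (LINT x|lborel. k 1 1 x x)
        + (LINT x|lborel. of_real (V x) * k 0 0 x x)"
    by (simp add: kinetic_integral)
  finally show ?thesis
    using expectation_mult_op[of V] integrable_V_partials[of 0 0]
    by (simp add: expectation_def[of "hamiltonian hbar m V"] kinetic_def)
qed

end

subsection \<open>Energy balance\<close>

context moment_state
begin

text \<open>Friction, with coefficient \<open>\<eta>\<close>, gives the loss of kinetic energy and
  the virial term. Diffusion along the diagonal, with coefficient \<open>\<nu>\<^sup>2\<close>,
  meets the curvature of \<open>V\<close>. The square of \<open>x - y\<close>, with coefficient
  \<open>\<mu>\<^sup>2\<close>, gives constant heating because the trace is one.\<close>

lemma energy_balance:
  fixes \<Omega> kB T \<eta> :: real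
  defines "\<mu> \<equiv> qld_mu hbar m \<Omega> kB T \<eta>" and "\<nu> \<equiv> qld_nu hbar m \<Omega> kB T \<eta>"
  assumes \<eta>: "2 * \<mu> * \<nu> * hbar = \<eta>"
  shows "expectation (hamiltonian hbar m V) (lindbladian hbar m \<Omega> kB T \<eta> V \<kappa>)
    = - 2 * \<eta> * kinetic - \<eta> * Re (LINT x|lborel. of_real x * (of_real (V' x) * k 0 0 x x))
      + \<nu>\<^sup>2 * hbar\<^sup>2 * expectation (mult_op V'') \<kappa> + \<mu>\<^sup>2 * hbar\<^sup>2 / m"
proof -
  \<comment> \<open>Opaque complex constants turn the later comparison of integrands into a purely
    algebraic identity.\<close>
  define h M N E W :: complex where "h = of_real hbar" and "M = of_real (\<mu>\<^sup>2)"
    and "N = of_real (\<nu>\<^sup>2 * hbar\<^sup>2)" and "E = of_real \<eta>" and "W = of_real m"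
  have nz: "h \<noteq> 0" "W \<noteq> 0" using hbar m by (auto simp: h_def W_def)
  define G :: kernel where "G x y = \<i> * (h / (2 * W)) * (k 2 0 x y - k 0 2 x y)
      - \<i> / h * ((of_real (V x) - of_real (V y)) * k 0 0 x y)
      - M * ((of_real x - of_real y)\<^sup>2 * k 0 0 x y)
      + E * (of_real x * k 0 1 x y + of_real y * k 1 0 x y + k 0 0 x y)
      + N * (k 2 0 x y + 2 * k 1 1 x y + k 0 2 x y)" for x y
  have "smooth_kernel 2 \<kappa>"
    using smooth_kernel_mono[OF smooth] by simp
  then have G: "lindbladian hbar m \<Omega> kB T \<eta> V \<kappa> = G"
    using hbar m \<eta>
    by (intro ext) (simp add: lindbladian_apply \<mu>_def \<nu>_def G_def h_def M_def N_def E_def W_def)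
  \<comment> \<open>The Hamiltonian acts from the right, so \<open>G\<close> is differentiated twice
    in its second variable only.\<close>
  define G1 where "G1 x y = \<i> * (h / (2 * W)) * (k 2 1 x y - k 0 3 x y)
      - \<i> / h * ((of_real (V x) - of_real (V y)) * k 0 1 x y - of_real (V' y) * k 0 0 x y)
      - M * ((of_real x - of_real y)\<^sup>2 * k 0 1 x y - 2 * ((of_real x - of_real y) * k 0 0 x y))
      + E * (of_real x * k 0 2 x y + (of_real y * k 1 1 x y + k 1 0 x y) + k 0 1 x y)
      + N * (k 2 1 x y + 2 * k 1 2 x y + k 0 3 x y)" for x y
  \<comment> \<open>The second derivative is wanted on the diagonal alone, where all terms with a
    factor \<open>x - y\<close> or \<open>V x - V y\<close> disappear. It keeps the unsimplified
    shape that the differentiation rules produce.\<close>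
  define G2 where "G2 x = \<i> * (h / (2 * W)) * (k 2 2 x x - k 0 4 x x)
      - \<i> / h * (- of_real (V' x) * k 0 1 x x - (of_real (V' x) * k 0 1 x x + of_real (V'' x) * k 0 0 x x))
      - M * (0 - 2 * (- k 0 0 x x))
      + E * (of_real x * k 0 3 x x + (of_real x * k 1 2 x x + k 1 1 x x + k 1 1 x x) + k 0 2 x x)
      + N * (k 2 2 x x + 2 * k 1 3 x x + k 0 4 x x)" for x
  have D2s: "((\<lambda>s. k a b x s) has_vector_derivative k a c x y) (at y)"
    if "c = Suc b" "a + b < 4" for a b c x y
    using D2[OF that(2)] that(1) by simp
  have Vc: "((\<lambda>x. complex_of_real (V x)) has_vector_derivative of_real (V' x)) (at x)"
    "((\<lambda>x. complex_of_real (V' x)) has_vector_derivative of_real (V'' x)) (at x)" for x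
    by (intro has_vector_derivative_of_real V V')+
  have xc: "((\<lambda>x. complex_of_real x) has_vector_derivative 1) (at x)" for x :: real
    using has_vector_derivative_of_real[OF DERIV_ident] by simp
  \<comment> \<open>Otherwise \<open>k 0 0\<close> would turn into \<open>\<kappa>\<close> and no
    longer match the rules for \<open>k a b\<close>.\<close>
  note [simp del] = partials_0
  note product = has_vector_derivative_eq_rhs[OF has_vector_derivative_mult]
  have Vd: "((\<lambda>s. complex_of_real (V x) - of_real (V s)) has_vector_derivative 0 - of_real (V' y)) (at y)"
    and xd: "((\<lambda>s. complex_of_real x - of_real s) has_vector_derivative 0 - 1) (at y)" for x y
    by (intro has_vector_derivative_diff has_vector_derivative_const Vc xc)+
  have sq: "((\<lambda>s. (complex_of_real x - of_real s)\<^sup>2) has_vector_derivative - 2 * (of_real x - of_real y)) (at y)"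
    for x y :: real
    unfolding power2_eq_square by (rule product[OF xd xd]) simp
  have tV: "((\<lambda>s. (of_real (V x) - of_real (V s)) * k 0 b x s) has_vector_derivative
      (of_real (V x) - of_real (V y)) * k 0 (Suc b) x y - of_real (V' y) * k 0 b x y) (at y)"
    if "b < 4" for b x y
    by (rule product[OF Vd D2]) (use that in simp_all)
  have tV': "((\<lambda>s. of_real (V' s) * k 0 0 x s) has_vector_derivative
      of_real (V' y) * k 0 1 x y + of_real (V'' y) * k 0 0 x y) (at y)" for x y
    by (rule product[OF Vc(2) D2]) simp_all
  have tq: "((\<lambda>s. (of_real x - of_real s)\<^sup>2 * k 0 b x s) has_vector_derivative
      (of_real x - of_real y)\<^sup>2 * k 0 (Suc b) x y - 2 * ((of_real x - of_real y) * k 0 b x y)) (at y)"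
    if "b < 4" for b x y
    by (rule product[OF sq D2]) (use that in \<open>simp_all add: algebra_simps\<close>)
  have tl: "((\<lambda>s. (of_real x - of_real s) * k 0 0 x s) has_vector_derivative
      (of_real x - of_real y) * k 0 1 x y - k 0 0 x y) (at y)" for x y
    by (rule product[OF xd D2]) simp_all
  have ty: "((\<lambda>s. of_real s * k 1 b x s) has_vector_derivative
      of_real y * k 1 (Suc b) x y + k 1 b x y) (at y)" if "b < 3" for b x y
    by (rule product[OF xc D2]) (use that in simp_all)
  note lin = has_vector_derivative_add has_vector_derivative_diff has_vector_derivative_mult_right
  have G1: "((\<lambda>s. G x s) has_vector_derivative G1 x y) (at y)" for x y
    unfolding G_def G1_def
    using tV[of 0 x y] tq[of 0 x y] ty[of 0 x y]
    by (intro lin D2s) auto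
  have G2: "((\<lambda>s. G1 x s) has_vector_derivative G2 x) (at x)" for x
    unfolding G1_def G2_def
    using tV[of 1 x x] tV'[of x x] tq[of 1 x x] tl[of x x] ty[of 1 x x]
    by (intro lin D2s) (auto simp: numeral_2_eq_2)
  define I where "I x = - (h\<^sup>2 / (2 * W)) * G2 x + of_real (V x) * G x x" for x
  have I: "rmul_adj (hamiltonian hbar m V) G x x = I x" for x
    using rmul_adj_hamiltonian_apply[OF G1 G2, of hbar m V]
    by (simp add: I_def h_def W_def)
  text \<open>The total derivative contained in the integrand \<open>I\<close>: what is left, \<open>R\<close> below, has only
    terms with a sign or a bound.\<close>
  define P where "P x = \<i> * (h / (2 * W)) * (of_real (V x) * k 1 0 x x - of_real (V x) * k 0 1 x x
        - of_real (V' x) * k 0 0 x x)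
      + E * (of_real x * (of_real (V x) * k 0 0 x x))
      + N * (of_real (V x) * k 1 0 x x + of_real (V x) * k 0 1 x x - of_real (V' x) * k 0 0 x x)
      - h\<^sup>2 / (2 * W) * (\<i> * (h / (2 * W)) * (k 1 2 x x - k 0 3 x x) + E * (of_real x * k 0 2 x x)
        + N * (k 1 2 x x + k 0 3 x x))" for x
  \<comment> \<open>The derivative of \<open>P\<close> along the diagonal. Each term is covered by
    moments of weight at most 4, so \<open>P'\<close> is integrable as well.\<close>
  define P' where "P' x = \<i> * (h / (2 * W)) *
        (of_real (V' x) * k 1 0 x x + of_real (V x) * k 2 0 x x + of_real (V x) * k 1 1 x x
        - (of_real (V' x) * k 0 1 x x + of_real (V x) * k 1 1 x x + of_real (V x) * k 0 2 x x)
        - (of_real (V'' x) * k 0 0 x x + of_real (V' x) * k 1 0 x x + of_real (V' x) * k 0 1 x x))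
      + E * (of_real (V x) * k 0 0 x x + of_real x * (of_real (V' x) * k 0 0 x x)
        + of_real x * (of_real (V x) * k 1 0 x x) + of_real x * (of_real (V x) * k 0 1 x x))
      + N * (of_real (V' x) * k 1 0 x x + of_real (V x) * k 2 0 x x + of_real (V x) * k 1 1 x x
        + (of_real (V' x) * k 0 1 x x + of_real (V x) * k 1 1 x x + of_real (V x) * k 0 2 x x)
        - (of_real (V'' x) * k 0 0 x x + of_real (V' x) * k 1 0 x x + of_real (V' x) * k 0 1 x x))
      - h\<^sup>2 / (2 * W) * (\<i> * (h / (2 * W)) * (k 2 2 x x + k 1 3 x x - (k 1 3 x x + k 0 4 x x))
        + E * (k 0 2 x x + of_real x * k 1 2 x x + of_real x * k 0 3 x x)
        + N * (k 2 2 x x + k 1 3 x x + (k 1 3 x x + k 0 4 x x)))" for x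
  have Ds: "((\<lambda>x. k a b x x) has_vector_derivative k c b x x + k a d x x) (at x)"
    if "c = Suc a" "d = Suc b" "a + b < 4" for a b c d x
    using D_diag[OF that(3)] that(1,2) by simp
  have Vk: "((\<lambda>x. of_real (V x) * k a b x x) has_vector_derivative
      of_real (V' x) * k a b x x + of_real (V x) * k (Suc a) b x x + of_real (V x) * k a (Suc b) x x) (at x)"
    if "a + b < 4" for a b x
    by (rule product[OF Vc(1) D_diag]) (use that in \<open>simp_all add: algebra_simps\<close>)
  have V'k: "((\<lambda>x. of_real (V' x) * k 0 0 x x) has_vector_derivative
      of_real (V'' x) * k 0 0 x x + of_real (V' x) * k 1 0 x x + of_real (V' x) * k 0 1 x x) (at x)" for x
    by (rule product[OF Vc(2) D_diag]) (simp_all add: algebra_simps)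
  have xVk: "((\<lambda>x. of_real x * (of_real (V x) * k 0 0 x x)) has_vector_derivative
      of_real (V x) * k 0 0 x x + of_real x * (of_real (V' x) * k 0 0 x x)
        + of_real x * (of_real (V x) * k 1 0 x x) + of_real x * (of_real (V x) * k 0 1 x x)) (at x)" for x
    by (rule product[OF xc Vk]) (simp_all add: algebra_simps)
  have xk: "((\<lambda>x. of_real x * k 0 2 x x) has_vector_derivative
      k 0 2 x x + of_real x * k 1 2 x x + of_real x * k 0 3 x x) (at x)" for x
    by (rule product[OF xc D_diag]) (simp_all add: algebra_simps numeral_2_eq_2 numeral_3_eq_3)
  have P: "(P has_vector_derivative P' x) (at x)" for x
    unfolding P_def P'_def
    using Vk[of 1 0 x] Vk[of 0 1 x] V'k[of x] xVk[of x] xk[of x]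
    by (intro lin Ds) (auto simp: numeral_2_eq_2)
  note ints = integrable_partials integrable_x_partials integrable_V_partials
    integrable_x_V_partials integrable_V'_partials integrable_x_V' integrable_V''
  have "integrable lborel P"
    unfolding P_def
    by (intro Bochner_Integration.integrable_add Bochner_Integration.integrable_diff integrable_mult_right ints)
      auto
  moreover have P'_int: "integrable lborel P'"
    unfolding P'_def
    by (intro Bochner_Integration.integrable_add Bochner_Integration.integrable_diff integrable_mult_right ints)
      auto
  ultimately have P'0: "(LINT x|lborel. P' x) = 0"
    by (intro integral_derivative_eq_0[OF P])
  define R where "R x = - E * (of_real x * (of_real (V' x) * k 0 0 x x))
      + N * (of_real (V'' x) * k 0 0 x x) + h\<^sup>2 / W * M * k 0 0 x x - h\<^sup>2 / W * E * k 1 1 x x" for x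
  \<comment> \<open>The commutator with the Hamiltonian is absorbed by \<open>P'\<close> completely,
    which is energy conservation of the unitary part. Only friction, diffusion and heating leave
    something in \<open>R\<close>.\<close>
  have IPR: "I x = P' x + R x" for x
    unfolding I_def P'_def R_def G_def G2_def using nz
    by (simp add: field_simps power2_eq_square)
  have R_int: "integrable lborel R"
    unfolding R_def
    by (intro Bochner_Integration.integrable_add Bochner_Integration.integrable_diff integrable_mult_right ints)
      auto
  have "kernel_trace (rmul_adj (hamiltonian hbar m V) G) = (LINT x|lborel. R x)"
    using P'_int R_int P'0 by (simp add: kernel_trace_def I IPR)
  also have "\<dots> = - E * (LINT x|lborel. of_real x * (of_real (V' x) * k 0 0 x x))
      + N * (LINT x|lborel. of_real (V'' x) * k 0 0 x x) + h\<^sup>2 / W * M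
      - h\<^sup>2 / W * E * (LINT x|lborel. k 1 1 x x)"
    unfolding R_def
    using integrable_x_V' integrable_V'' integrable_partials[of 0 0] integrable_partials[of 1 1]
      integral_diagonal by simp
  finally have "expectation (hamiltonian hbar m V) G
    = Re (- E * (LINT x|lborel. of_real x * (of_real (V' x) * k 0 0 x x))
      + N * (LINT x|lborel. of_real (V'' x) * k 0 0 x x) + h\<^sup>2 / W * M
      - h\<^sup>2 / W * E * (LINT x|lborel. k 1 1 x x))"
    by (simp add: expectation_def)
  also have "\<dots> = - \<eta> * Re (LINT x|lborel. of_real x * (of_real (V' x) * k 0 0 x x))
      + \<nu>\<^sup>2 * hbar\<^sup>2 * expectation (mult_op V'') \<kappa> + \<mu>\<^sup>2 * hbar\<^sup>2 / m
      - hbar\<^sup>2 / m * \<eta> * Re (LINT x|lborel. k 1 1 x x)"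
  proof -
    have c: "h\<^sup>2 / W * M = of_real (\<mu>\<^sup>2 * hbar\<^sup>2 / m)" "h\<^sup>2 / W * E = of_real (hbar\<^sup>2 / m * \<eta>)"
      by (simp_all add: h_def W_def M_def E_def)
    show ?thesis
      unfolding c unfolding N_def E_def expectation_mult_op[OF integrable_V'']
      by (simp only: minus_complex.sel plus_complex.sel uminus_complex.sel Re_complex_of_real
          of_real_minus[symmetric] times_complex.sel Im_complex_of_real mult_zero_left diff_zero)
  qed
  finally show ?thesis
    unfolding G using m by (simp add: kinetic_def)
qed

end

subsection \<open>Decay of the energy\<close>

lemma qld_mu_nu:
  assumes "hbar > 0" "m > 0" "\<Omega> > 0" "kB > 0" "T > 0" "\<eta> > 0"
  defines "z \<equiv> hbar * \<Omega> / (4 * kB * T)"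
  shows qld_mu_sqr: "(qld_mu hbar m \<Omega> kB T \<eta>)\<^sup>2 = \<eta> * m * \<Omega> / (2 * hbar) * coth z"
    and qld_nu_sqr: "(qld_nu hbar m \<Omega> kB T \<eta>)\<^sup>2 = \<eta> / (2 * hbar * m * \<Omega>) * tanh z"
    and qld_mu_nu_mult: "2 * qld_mu hbar m \<Omega> kB T \<eta> * qld_nu hbar m \<Omega> kB T \<eta> * hbar = \<eta>"
proof -
  have z: "z > 0" using assms by (simp add: z_def)
  have c: "coth z > 0" and t: "tanh z > 0" and ct: "coth z * tanh z = 1"
    using z by (auto simp: coth_def tanh_def)
  show 1: "(qld_mu hbar m \<Omega> kB T \<eta>)\<^sup>2 = \<eta> * m * \<Omega> / (2 * hbar) * coth z"
    using assms c by (simp add: qld_mu_def z_def[symmetric])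
  show 2: "(qld_nu hbar m \<Omega> kB T \<eta>)\<^sup>2 = \<eta> / (2 * hbar * m * \<Omega>) * tanh z"
    using assms t by (simp add: qld_nu_def z_def[symmetric])
  have "qld_mu hbar m \<Omega> kB T \<eta> * qld_nu hbar m \<Omega> kB T \<eta>
      = sqrt ((\<eta> * m * \<Omega> / (2 * hbar) * coth z) * (\<eta> / (2 * hbar * m * \<Omega>) * tanh z))"
    unfolding qld_mu_def qld_nu_def z_def by (rule real_sqrt_mult[symmetric])
  also have "(\<eta> * m * \<Omega> / (2 * hbar) * coth z) * (\<eta> / (2 * hbar * m * \<Omega>) * tanh z)
      = (\<eta> / (2 * hbar))\<^sup>2 * (coth z * tanh z)"
    using assms by (simp add: field_simps power2_eq_square)
  also have "sqrt \<dots> = \<eta> / (2 * hbar)"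
    unfolding ct using assms(1,6) by simp
  finally show "2 * qld_mu hbar m \<Omega> kB T \<eta> * qld_nu hbar m \<Omega> kB T \<eta> * hbar = \<eta>"
    using assms by (simp add: field_simps)
qed

text \<open>After multiplication by \<open>sinh z\<close>, the lower bound \<open>0\<close> holds
  since \<open>z * cosh z - sinh z\<close> vanishes at \<open>0\<close> and has derivative
  \<open>z * sinh z\<close>. The upper bound reduces to \<open>z * exp (- z) \<le> sinh z\<close>,
  that is, \<open>1 + 2 * z \<le> exp (2 * z)\<close>.\<close>

lemma abs_mult_coth_minus_1_le:
  fixes z :: real
  assumes "z > 0"
  shows "\<bar>z * coth z - 1\<bar> \<le> z"
proof -
  have s: "sinh z > 0" using assms by simp
  have "cosh z * z - sinh z \<ge> 0"
  proof -
    have "(\<lambda>z. cosh z * z - sinh z) 0 \<le> (\<lambda>z::real. cosh z * z - sinh z) z"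
    proof (rule DERIV_nonneg_imp_nondecreasing[where f = "\<lambda>z. cosh z * z - sinh z"])
      show "\<exists>y. ((\<lambda>z. cosh z * z - sinh z) has_real_derivative y) (at x) \<and> 0 \<le> y"
        if "0 \<le> x" for x :: real
        using that by (intro exI[of _ "sinh x * x"]) (auto intro!: derivative_eq_intros)
    qed (use assms in simp)
    then show ?thesis by simp
  qed
  moreover have "cosh z * z - sinh z \<le> z * sinh z"
  proof -
    have "z * (cosh z - sinh z) = z * exp (- z)" by (simp add: cosh_minus_sinh)
    also have "\<dots> \<le> sinh z"
    proof -
      have "1 + 2 * z \<le> exp (2 * z)" by (rule exp_ge_add_one_self)
      then have "(2 * z + 1) * exp (- z) \<le> exp (2 * z) * exp (- z)"
        by (intro mult_right_mono) (simp_all add: add.commute)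
      also have "exp (2 * z) * exp (- z) = exp z" by (simp flip: exp_add)
      finally show ?thesis by (simp add: sinh_def algebra_simps)
    qed
    finally show ?thesis by (simp add: algebra_simps)
  qed
  moreover have "z * coth z - 1 = (cosh z * z - sinh z) / sinh z"
    using s by (simp add: coth_def field_simps)
  ultimately show ?thesis
    using s by (simp add: pos_divide_le_eq)
qed

text \<open>With the integrating factor \<open>exp (a * s)\<close>, the excess of \<open>e\<close>
  over the equilibrium level \<open>c\<close> is nonincreasing.\<close>

lemma gronwall_affine:
  fixes e e' :: "real \<Rightarrow> real"
  assumes der: "\<And>t. t \<ge> 0 \<Longrightarrow> (e has_real_derivative e' t) (at t within {0..})"
    and le: "\<And>t. t \<ge> 0 \<Longrightarrow> e' t \<le> - a * (e t - c)" and t: "t \<ge> 0"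
  shows "e t \<le> c + (e 0 - c) * exp (- a * t)"
proof -
  define g where "g s = (e s - c) * exp (a * s)" for s
  have g: "(g has_real_derivative (e' s + a * (e s - c)) * exp (a * s)) (at s within {0..})"
    if "s \<ge> 0" for s
    unfolding g_def
    by (auto intro!: derivative_eq_intros der[OF that] simp: algebra_simps)
  have "g t \<le> g 0"
  proof (rule DERIV_nonpos_imp_decreasing_open[OF t])
    fix s :: real assume s: "0 < s" "s < t"
    \<comment> \<open>At interior times the one-sided derivative is two-sided; at the endpoints
      continuity suffices.\<close>
    have "at s within {0..} = at s"
      using s by (intro at_within_interior) auto
    with g[of s] s have "DERIV g s :> (e' s + a * (e s - c)) * exp (a * s)" by simp
    moreover have "(e' s + a * (e s - c)) * exp (a * s) \<le> 0"
      using le[of s] s by (intro mult_nonpos_nonneg) auto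
    ultimately show "\<exists>y. DERIV g s :> y \<and> y \<le> 0" by blast
  next
    show "continuous_on {0..t} g"
      by (intro DERIV_continuous_on[OF has_field_derivative_subset[OF g]]) auto
  qed
  then have "(e t - c) * exp (a * t) * exp (- a * t) \<le> (e 0 - c) * exp (- a * t)"
    by (intro mult_right_mono) (auto simp: g_def)
  then show ?thesis by (simp add: mult.assoc flip: exp_add)
qed

text \<open>The order of the quantifiers carries the asymptotics: \<open>C\<close> and
  \<open>\<epsilon>0\<close> may depend only on \<open>m\<close>, \<open>\<Omega>\<close> and the
  curvature bound \<open>S\<close>; \<open>\<zeta>\<close> is fixed before the potential and the
  solution; \<open>K\<close> may depend on the solution but not on \<open>t\<close>.\<close>

theorem theorem3:
  fixes m \<Omega> S :: real
  assumes "m > 0" and "\<Omega> > 0"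
  shows "\<exists>C \<epsilon>0 :: real. \<epsilon>0 > 0 \<and>
    (\<forall>hbar kB T \<eta> r :: real.
       hbar > 0 \<and> kB > 0 \<and> T > 0 \<and> \<eta> > 0 \<and> 0 < r \<and> r < 1 \<and> hbar * \<Omega> / (kB * T) < \<epsilon>0 \<longrightarrow>
       (\<exists>\<zeta> :: real. \<bar>\<zeta> - 2\<bar> \<le> C * (hbar * \<Omega> / (kB * T)) \<and>
         (\<forall>(V :: real \<Rightarrow> real) (xmin :: real) (\<rho> :: real \<Rightarrow> kernel).
            (\<forall>x. V differentiable (at x)) \<and> continuous_on UNIV (deriv V) \<and>
            (\<forall>x. deriv V differentiable (at x)) \<and>
            (\<forall>x. x \<noteq> xmin \<longrightarrow> V xmin < V x) \<and>
            (\<forall>x. x * deriv V x \<ge> r * V x \<and> r * V x \<ge> 0) \<and>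
            qld_solution hbar m \<Omega> kB T \<eta> V \<rho> \<and>
            qld_regular hbar m \<Omega> kB T \<eta> V \<rho> \<and>
            (\<forall>t\<ge>0. expectation (mult_op (deriv (deriv V))) (\<rho> t) \<le> S) \<and>
            expectation (hamiltonian hbar m V) (\<rho> 0) - \<zeta> / r * kB * T \<ge> 0 \<longrightarrow>
            (\<exists>K. \<forall>t\<ge>0. expectation (mult_op V) (\<rho> t) - V xmin
                          \<le> \<zeta> / r * kB * T + K * exp (- \<eta> * r * t)))))"
proof (rule exI[of _ "1 / 2 + \<bar>S\<bar> / (2 * m * \<Omega>\<^sup>2)"], rule exI[of _ "1::real"],
    intro conjI allI impI; (elim conjE)?)
  show "(0::real) < 1" by simp
next
  fix hbar kB T \<eta> r :: real
  assume pos: "hbar > 0" "kB > 0" "T > 0" "\<eta> > 0" "0 < r" "r < 1"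
  define u where "u = hbar * \<Omega> / (kB * T)"
  define z where "z = hbar * \<Omega> / (4 * kB * T)"
  have u: "u > 0" "z = u / 4" using pos assms by (auto simp: u_def z_def)
  \<comment> \<open>Chosen so that the heating terms of the energy balance, with the expectation of
    \<open>V''\<close> replaced by \<open>S\<close>, add up to
    \<open>\<eta> * (\<zeta> * kB * T)\<close>. The \<open>\<mu>\<^sup>2\<close> term gives the
    first summand, which tends to 2, and the \<open>\<nu>\<^sup>2\<close> term gives the
    second.\<close>
  define \<zeta> where "\<zeta> = 2 * (z * coth z) + S * u / (2 * m * \<Omega>\<^sup>2) * tanh z"
  let ?\<mu> = "qld_mu hbar m \<Omega> kB T \<eta>" and ?\<nu> = "qld_nu hbar m \<Omega> kB T \<eta>"
  note \<mu> = qld_mu_sqr[OF pos(1) assms pos(2-4), folded z_def]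
  note \<nu> = qld_nu_sqr[OF pos(1) assms pos(2-4), folded z_def]
  note \<mu>\<nu> = qld_mu_nu_mult[OF pos(1) assms pos(2-4)]
  have \<zeta>: "?\<nu>\<^sup>2 * hbar\<^sup>2 * S + ?\<mu>\<^sup>2 * hbar\<^sup>2 / m = \<eta> * (\<zeta> * kB * T)"
    unfolding \<mu> \<nu> \<zeta>_def using pos assms
    by (simp add: u_def z_def field_simps power2_eq_square)
  \<comment> \<open>The \<open>1 / 2\<close> comes from the error \<open>2 * z = u / 2\<close> of
    the \<open>coth\<close> term; the rest comes from
    \<open>\<bar>tanh z\<bar> \<le> 1\<close>.\<close>
  have "\<bar>\<zeta> - 2\<bar> \<le> (1 / 2 + \<bar>S\<bar> / (2 * m * \<Omega>\<^sup>2)) * u"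
  proof -
    have "\<zeta> - 2 = 2 * (z * coth z - 1) + S * u / (2 * m * \<Omega>\<^sup>2) * tanh z"
      by (simp add: \<zeta>_def)
    also have "\<bar>\<dots>\<bar> \<le> \<bar>2 * (z * coth z - 1)\<bar> + \<bar>S * u / (2 * m * \<Omega>\<^sup>2) * tanh z\<bar>"
      by (rule abs_triangle_ineq)
    also have "\<bar>2 * (z * coth z - 1)\<bar> \<le> 2 * z"
      using abs_mult_coth_minus_1_le[of z] u by (simp only: abs_mult) simp
    also have "\<bar>S * u / (2 * m * \<Omega>\<^sup>2) * tanh z\<bar> = \<bar>S * u / (2 * m * \<Omega>\<^sup>2)\<bar> * \<bar>tanh z\<bar>"
      by (rule abs_mult)
    also have "\<dots> \<le> \<bar>S * u / (2 * m * \<Omega>\<^sup>2)\<bar> * 1"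
      using tanh_real_bounds[of z] by (intro mult_left_mono) auto
    also have "\<bar>S * u / (2 * m * \<Omega>\<^sup>2)\<bar> * 1 = \<bar>S\<bar> / (2 * m * \<Omega>\<^sup>2) * u"
      using assms u by (simp add: abs_mult)
    finally show ?thesis using u by (simp add: algebra_simps)
  qed
  moreover
  { fix V :: "real \<Rightarrow> real" and xmin :: real and \<rho> :: "real \<Rightarrow> kernel"
    assume V: "\<forall>x. V differentiable (at x)" "\<forall>x. deriv V differentiable (at x)"
      and rV: "\<forall>x. x * deriv V x \<ge> r * V x \<and> r * V x \<ge> 0"
      and sol: "qld_solution hbar m \<Omega> kB T \<eta> V \<rho>"
      and reg: "qld_regular hbar m \<Omega> kB T \<eta> V \<rho>"
      and S: "\<forall>t\<ge>0. expectation (mult_op (deriv (deriv V))) (\<rho> t) \<le> S"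
    have state: "moment_state hbar m V (deriv V) (deriv (deriv V)) (\<rho> t)" if "t \<ge> 0" for t
      using that V pos(1) assms(1) sol reg
      by unfold_locales
        (auto simp: qld_solution_def qld_regular_def DERIV_deriv_iff_real_differentiable)
    have V0: "V x \<ge> 0" for x using rV pos by (simp add: zero_le_mult_iff)
    define e where "e t = expectation (hamiltonian hbar m V) (\<rho> t)" for t
    define e' where
      "e' t = expectation (hamiltonian hbar m V) (lindbladian hbar m \<Omega> kB T \<eta> V (\<rho> t))" for t
    define c where "c = \<zeta> / r * kB * T"
    have e: "(e has_real_derivative e' t) (at t within {0..})" if "t \<ge> 0" for t
      using reg that by (simp add: qld_regular_def e_def[abs_def] e'_def)
    have le: "e' t \<le> - (\<eta> * r) * (e t - c)" and Ve: "expectation (mult_op V) (\<rho> t) \<le> e t" if "t \<ge> 0" for t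
    proof -
      interpret moment_state hbar m V "deriv V" "deriv (deriv V)" "\<rho> t"
        by (rule state[OF that])
      let ?X = "LINT x|lborel. of_real x * (of_real (deriv V x) * k 0 0 x x)"
      have EV: "expectation (mult_op V) (\<rho> t) = (LINT x|lborel. V x * Re (k 0 0 x x))"
        using expectation_mult_op[of V] integrable_V_partials[of 0 0]
        by (simp flip: integral_Re)
      \<comment> \<open>The pointwise growth condition on \<open>V\<close> is integrated against the
        nonnegative diagonal density.\<close>
      have "r * expectation (mult_op V) (\<rho> t) = (LINT x|lborel. r * (V x * Re (k 0 0 x x)))"
        by (simp add: EV)
      also have "\<dots> \<le> (LINT x|lborel. Re (of_real x * (of_real (deriv V x) * k 0 0 x x)))"
      proof (rule integral_mono)
        show "integrable lborel (\<lambda>x. r * (V x * Re (k 0 0 x x)))"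
          using integrable_Re[OF integrable_V_partials[of 0 0]] by simp
        show "integrable lborel (\<lambda>x. Re (of_real x * (of_real (deriv V x) * k 0 0 x x)))"
          by (intro integrable_Re integrable_x_V')
        show "r * (V x * Re (k 0 0 x x)) \<le> Re (of_real x * (of_real (deriv V x) * k 0 0 x x))" for x
          using mult_right_mono[of "r * V x" "x * deriv V x", OF _ diagonal_nonneg[of x]] rV
          by (simp add: mult.assoc)
      qed
      also have "\<dots> = Re ?X"
        by (rule integral_Re[OF integrable_x_V'])
      finally have X: "r * expectation (mult_op V) (\<rho> t) \<le> Re ?X" .
      have "e' t \<le> - 2 * \<eta> * kinetic - \<eta> * Re ?X + (?\<nu>\<^sup>2 * hbar\<^sup>2 * S + ?\<mu>\<^sup>2 * hbar\<^sup>2 / m)"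
        using energy_balance[OF \<mu>\<nu>] S that by (simp add: e'_def mult_left_mono)
      also have "\<dots> \<le> - (\<eta> * r) * kinetic - \<eta> * (r * expectation (mult_op V) (\<rho> t)) + \<eta> * (\<zeta> * kB * T)"
      proof -
        \<comment> \<open>The kinetic damping \<open>2\<close> is weakened to \<open>r\<close>, so
          that kinetic and potential energy share the rate \<open>\<eta> * r\<close> and combine
          into the total energy.\<close>
        have "\<eta> * (r * kinetic) \<le> \<eta> * (2 * kinetic)"
          using kinetic_nonneg pos by (intro mult_left_mono mult_right_mono) auto
        moreover have "\<eta> * (r * expectation (mult_op V) (\<rho> t)) \<le> \<eta> * Re ?X"
          using X pos by (intro mult_left_mono) auto
        ultimately show ?thesis unfolding \<zeta> by (simp add: algebra_simps)
      qed
      also have "\<dots> = - (\<eta> * r) * (e t - c)"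
        using pos by (simp add: e_def expectation_hamiltonian c_def field_simps)
      finally show "e' t \<le> - (\<eta> * r) * (e t - c)" .
      show "expectation (mult_op V) (\<rho> t) \<le> e t"
        using kinetic_nonneg by (simp add: e_def expectation_hamiltonian)
    qed
    \<comment> \<open>The total energy dominates the potential energy, and subtracting
      \<open>V xmin \<ge> 0\<close> only lowers the left side; \<open>K\<close> is the initial
      excess \<open>e 0 - c\<close>.\<close>
    have "expectation (mult_op V) (\<rho> t) - V xmin \<le> c + (e 0 - c) * exp (- \<eta> * r * t)" if "t \<ge> 0" for t
      using gronwall_affine[of e e' "\<eta> * r" c t, OF e le that] Ve[OF that] V0[of xmin] by simp
    then have "\<exists>K. \<forall>t\<ge>0. expectation (mult_op V) (\<rho> t) - V xmin \<le> c + K * exp (- \<eta> * r * t)"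
      by blast
    then have "\<exists>K. \<forall>t\<ge>0. expectation (mult_op V) (\<rho> t) - V xmin
        \<le> \<zeta> / r * kB * T + K * exp (- \<eta> * r * t)"
      unfolding c_def .
  }
  ultimately show "\<exists>\<zeta>. \<bar>\<zeta> - 2\<bar> \<le> (1 / 2 + \<bar>S\<bar> / (2 * m * \<Omega>\<^sup>2)) * (hbar * \<Omega> / (kB * T)) \<and>
         (\<forall>(V :: real \<Rightarrow> real) (xmin :: real) (\<rho> :: real \<Rightarrow> kernel).
            (\<forall>x. V differentiable (at x)) \<and> continuous_on UNIV (deriv V) \<and>
            (\<forall>x. deriv V differentiable (at x)) \<and>
            (\<forall>x. x \<noteq> xmin \<longrightarrow> V xmin < V x) \<and>
            (\<forall>x. x * deriv V x \<ge> r * V x \<and> r * V x \<ge> 0) \<and>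
            qld_solution hbar m \<Omega> kB T \<eta> V \<rho> \<and>
            qld_regular hbar m \<Omega> kB T \<eta> V \<rho> \<and>
            (\<forall>t\<ge>0. expectation (mult_op (deriv (deriv V))) (\<rho> t) \<le> S) \<and>
            expectation (hamiltonian hbar m V) (\<rho> 0) - \<zeta> / r * kB * T \<ge> 0 \<longrightarrow>
            (\<exists>K. \<forall>t\<ge>0. expectation (mult_op V) (\<rho> t) - V xmin
                          \<le> \<zeta> / r * kB * T + K * exp (- \<eta> * r * t)))"
    unfolding u_def by blast
qed

end
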